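(* Let $p,q$ be positive integers with $\gcd(p,q)=1$. Then in the $p$-braid word $B(p,q)=(\sigma_1\sigma_2\cdots\sigma_{p-1})^q$ there exist $(p-1)(q-1)/2$ crossings whose change gives a braid whose closure is a trivial knot.
   Context: $\sigma_1,\dots,\sigma_{p-1}$ are the elementary generators of the $p$-string braid group $\mathbb{B}_p$. Each letter of the braid word $B(p,q)$ is one crossing; changing a crossing means replacing the corresponding letter by its inverse. *)

theory Defs
  imports "HOL-Analysis.Analysis"
begin

datatype braid_letter = Gen nat | GenInv nat

type_synonym braid_word = "braid_letter list"

fun inv_letter :: "braid_letter \<Rightarrow> braid_letter" where
  "inv_letter (Gen i) = GenInv i"
| "inv_letter (GenInv i) = Gen i"

text \<open>Crossings are addressed by their position in the word, counted from 0.\<close>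

definition change_crossings :: "nat set \<Rightarrow> braid_word \<Rightarrow> braid_word" where
  "change_crossings S w =
     map (\<lambda>k. if k \<in> S then inv_letter (w ! k) else w ! k) [0..<length w]"

definition torus_word :: "nat \<Rightarrow> nat \<Rightarrow> braid_word" where
  "torus_word p q = concat (replicate q (map Gen [1..<p]))"

text \<open>
  A geometric braid on \<open>p\<close> strings is a loop of \<open>p\<close>-point configurations in the complex plane,
  based at \<open>{1,...,p}\<close>. The generator with index \<open>i\<close>, where \<open>1 \<le> i < p\<close>, exchanges the points
  \<open>i\<close> and \<open>i + 1\<close> by a counterclockwise half turn about their midpoint, and its inverse exchanges
  them by a clockwise half turn. (The opposite convention replaces every braid by its mirror image.)
\<close>

definition half_turn_config :: "nat \<Rightarrow> nat \<Rightarrow> real \<Rightarrow> complex set" where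
  "half_turn_config p i \<phi> =
     of_nat ` ({1..p} - {i, i + 1}) \<union>
     {of_nat i + 1/2 - cis \<phi> / 2, of_nat i + 1/2 + cis \<phi> / 2}"

fun letter_config :: "nat \<Rightarrow> braid_letter \<Rightarrow> real \<Rightarrow> complex set" where
  "letter_config p (Gen i) t = half_turn_config p i (pi * t)"
| "letter_config p (GenInv i) t = half_turn_config p i (- (pi * t))"

text \<open>
  The letter at position \<open>k\<close> is performed during the time interval \<open>[k, k + 1]\<close>. After the end of
  the word the configuration rests at \<open>{1,...,p}\<close>.
\<close>

definition braid_config :: "nat \<Rightarrow> braid_word \<Rightarrow> real \<Rightarrow> complex set" where
  "braid_config p w s =
     (if s < real (length w) then letter_config p (w ! nat \<lfloor>s\<rfloor>) (frac s)
      else of_nat ` {1..p})"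

text \<open>
  Three-space is \<open>complex \<times> real\<close>. The closure winds the braid once around the axis \<open>{0} \<times> \<real>\<close>:
  the configuration at time \<open>s\<close> is placed in the half-plane at angle \<open>2 \<pi> s / (n + 1)\<close>, real
  parts (which are at least 1) becoming distances from the axis and imaginary parts becoming
  heights. A word of length \<open>n\<close> occupies the times \<open>[0, n]\<close>; the times \<open>[n, n + 1]\<close> give the \<open>p\<close>
  parallel unlinked arcs that join the end of the braid to its beginning.
\<close>

definition braid_closure :: "nat \<Rightarrow> braid_word \<Rightarrow> (complex \<times> real) set" where
  "braid_closure p w =
     {(of_real (Re z) * cis (2 * pi * s / (real (length w) + 1)), Im z) | s z.
        s \<in> {0..real (length w) + 1} \<and> z \<in> braid_config p w s}"

definition ambient_isotopic :: "'a::euclidean_space set \<Rightarrow> 'a set \<Rightarrow> bool" where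
  "ambient_isotopic K L \<longleftrightarrow>
     (\<exists>H :: real \<Rightarrow> 'a \<Rightarrow> 'a.
        continuous_on ({0..1} \<times> UNIV) (\<lambda>(t, x). H t x) \<and>
        (\<forall>t\<in>{0..1}. \<exists>g. homeomorphism UNIV UNIV (H t) g) \<and>
        (\<forall>x. H 0 x = x) \<and>
        H 1 ` K = L)"

definition trivial_knot :: "(complex \<times> real) set \<Rightarrow> bool" where
  "trivial_knot K \<longleftrightarrow> ambient_isotopic K (sphere 0 1 \<times> {0})"

end

(*
A torus braid becomes unknotted once its closure is made ascending. Travel along the closure, starting
at position 1, and at every crossing let the passage that comes first be the lower one. In each factor
\<sigma>_1 ... \<sigma>_(p-1) the string moving from position 1 to position p passes below all the others, so the
crossings to change are those where this string belongs to a later passage than the other one. If the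
moving string of the j-th factor belongs to passage mu(j), there are mu(j) of them in that factor, and
mu(j) + mu(q - j) = p - 1 gives the total (p - 1)(q - 1)/2.

For an ascending closure the order of the heights over each double point agrees with the order of
travel, so a vertical isotopy makes the height increase all along the knot, except for a short fall at
the end. Now each horizontal plane meets the knot in at most two points. Translating the planes puts
the midpoint of the two points on an axis, and multiplying each plane by a complex number makes
their difference real; the result is a round circle.
*)

theory Submission imports Defs begin

section \<open>Ambient isotopies\<close>


text \<open>The target notion is an ambient isotopy, so every move must be a family of
  homeomorphisms of the whole space, not only a motion of the knot. This shapes the height change:
  heights prescribed on the knot have to be extended to increasing maps of all vertical lines,
  continuously in the line. Compactness achieves this once the projection separates nearby
  parameters at a linear rate. For a braid closure the angle around the axis provides that rate, so
  double points occur only between parameters at a definite distance.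

  The fall is placed on a resting arc, which has no crossings, and the window of parameters opens
  and closes inside the same arc. Near its top and bottom the knot therefore projects to an arc of
  the unit circle, and the difference of the two points in a plane has simple zeros there, like a
  sine. Hence the multipliers of the planes have nonzero limits and a continuous logarithm.

  Coprimality makes the labels m q + j, for fixed j, distinct modulo p: the closure is one
  component, and mu(j) is the unique m < p with p dividing m q + j. Its symmetry comes from (p - 1 -
  m) q + (q - j) = p q - (m q + j).\<close>

lemma ambient_isotopicI:
  fixes H :: "real \<Rightarrow> 'a::euclidean_space \<Rightarrow> 'a"
  assumes cont: "continuous_on ({0..1} \<times> UNIV) (\<lambda>(t, x). H t x)"
    and bij: "\<And>t. t \<in> {0..1} \<Longrightarrow> bij (H t)"
    and zero: "\<And>x. H 0 x = x"
    and one: "H 1 ` K = L"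
  shows "ambient_isotopic K L"
  unfolding ambient_isotopic_def
proof (intro exI[of _ H] conjI ballI)
  fix t :: real assume t: "t \<in> {0..1}"
  have "continuous_on UNIV ((\<lambda>(t, x). H t x) \<circ> (\<lambda>x. (t, x)))"
    by (rule continuous_on_compose)
      (use t in \<open>auto intro!: continuous_intros continuous_on_subset[OF cont]\<close>)
  then have "continuous_on UNIV (H t)"
    by (simp add: o_def)
  \<comment> \<open>Invariance of domain supplies the continuity of the inverse, so joint continuity
    and bijectivity at each time are enough.\<close>
  with bij[OF t] show "\<exists>g. homeomorphism UNIV UNIV (H t) g"
    using invariance_of_domain_homeomorphism[OF open_UNIV, of "H t"]
    by (metis bij_is_inj bij_is_surj order_refl)
qed (use assms in auto)

lemma ambient_isotopic_trans:
  fixes K L M :: "'a::euclidean_space set"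
  assumes "ambient_isotopic K L" and "ambient_isotopic L M"
  shows "ambient_isotopic K M"
proof -
  from assms(1) obtain H :: "real \<Rightarrow> 'a \<Rightarrow> 'a" where
    H: "continuous_on ({0..1} \<times> UNIV) (\<lambda>(t, x). H t x)"
      "\<forall>t\<in>{0..1}. \<exists>g. homeomorphism UNIV UNIV (H t) g" "\<forall>x. H 0 x = x" "H 1 ` K = L"
    unfolding ambient_isotopic_def by blast
  from assms(2) obtain G :: "real \<Rightarrow> 'a \<Rightarrow> 'a" where
    G: "continuous_on ({0..1} \<times> UNIV) (\<lambda>(t, x). G t x)"
      "\<forall>t\<in>{0..1}. \<exists>g. homeomorphism UNIV UNIV (G t) g" "\<forall>x. G 0 x = x" "G 1 ` L = M"
    unfolding ambient_isotopic_def by blast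
  show ?thesis
    unfolding ambient_isotopic_def
  proof (intro exI[of _ "\<lambda>t. G t \<circ> H t"] conjI ballI)
    have "continuous_on ({0..1} \<times> UNIV) ((\<lambda>(t, x). G t x) \<circ> (\<lambda>u. (fst u, (\<lambda>(t, x). H t x) u)))"
      by (rule continuous_on_compose)
        (auto intro!: continuous_intros H(1) intro: continuous_on_subset[OF G(1)])
    then show "continuous_on ({0..1} \<times> UNIV) (\<lambda>(t, x). (G t \<circ> H t) x)"
      by (simp add: o_def case_prod_unfold)
    show "\<exists>g. homeomorphism UNIV UNIV (G t \<circ> H t) g" if "t \<in> {0..1}" for t
      using H(2) G(2) that by (meson homeomorphism_compose)
    show "(G 1 \<circ> H 1) ` K = M"
      using H(4) G(4) by (metis image_comp)
  qed (use H G in auto)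
qed

text \<open>Growth at a rate bounded below makes each line map strictly monotone and unbounded in
  both directions; the intermediate value theorem then gives surjectivity.\<close>

lemma bij_increasing_on_lines:
  fixes G :: "'a \<Rightarrow> real \<Rightarrow> real"
  assumes cont: "\<And>x. continuous_on UNIV (G x)"
    and \<kappa>: "\<kappa> > 0" and incr: "\<And>x z s. s \<ge> 0 \<Longrightarrow> G x (z + s) \<ge> G x z + \<kappa> * s"
  shows "bij (\<lambda>(x, z). (x, G x z))"
proof -
  have mono: "G x z < G x z'" if "z < z'" for x z z'
    using incr[of "z' - z" x z] mult_pos_pos[OF \<kappa>, of "z' - z"] that by auto
  have surj: "\<exists>z. G x z = y" for x y
  proof -
    define b where "b = \<bar>y - G x 0\<bar> / \<kappa>"
    have b: "b \<ge> 0" "\<kappa> * b = \<bar>y - G x 0\<bar>"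
      using \<kappa> by (auto simp: b_def)
    have "y \<le> G x b"
      using incr[OF b(1), of x 0] b(2) by auto
    moreover have "G x (-b) \<le> y"
      using incr[OF b(1), of x "-b"] b(2) by auto
    ultimately show ?thesis
      using IVT'[of "G x" "-b" y b] b(1) continuous_on_subset[OF cont, of _ x] by auto
  qed
  show ?thesis
  proof (rule bijI)
    show "inj (\<lambda>(x, z). (x, G x z))"
      using mono by (auto simp: inj_on_def) (metis less_irrefl linorder_neqE_linordered_idom)
    show "surj (\<lambda>(x, z). (x, G x z))"
      using surj by (auto simp: surj_def) metis
  qed
qed

text \<open>A Lipschitz constant common to all \<open>u\<close> survives the supremum. This makes an
  envelope of infinitely many cones continuous.\<close>

lemma continuous_on_Sup_lipschitz:
  fixes h :: "'u \<Rightarrow> 'a::metric_space \<Rightarrow> real"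
  assumes "X \<noteq> {}"
    and bdd: "\<And>x. bdd_above ((\<lambda>u. h u x) ` X)"
    and lip: "\<And>u x y. u \<in> X \<Longrightarrow> h u x \<le> h u y + L * dist x y"
  shows "continuous_on UNIV (\<lambda>x. SUP u\<in>X. h u x)"
proof -
  have le: "(SUP u\<in>X. h u x) \<le> (SUP u\<in>X. h u y) + L * dist x y" for x y
  proof (rule cSUP_least[OF \<open>X \<noteq> {}\<close>])
    fix u assume u: "u \<in> X"
    show "h u x \<le> (SUP u\<in>X. h u y) + L * dist x y"
      using lip[OF u, of x y] cSUP_upper[OF u bdd[of y]] by linarith
  qed
  have L: "L * dist x y \<le> \<bar>L\<bar> * dist x y" for x y :: 'a
    by (intro mult_right_mono) auto
  have "dist (SUP u\<in>X. h u x) (SUP u\<in>X. h u y) \<le> \<bar>L\<bar> * dist x y" for x y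
    using le[of x y] le[of y x] L[of x y] by (auto simp: dist_real_def dist_commute)
  then have "\<bar>L\<bar>-lipschitz_on UNIV (\<lambda>x. SUP u\<in>X. h u x)"
    by (auto simp: lipschitz_on_def)
  then show ?thesis
    by (rule lipschitz_on_continuous_on)
qed

text \<open>
  Two links with the same projection and the same order over every double point: the height change
  extends to an increasing map \<open>F x\<close> of each vertical line. The map is a supremum of cones, steep
  enough to be dominated at the points of the link by the cone with apex there.
\<close>

lemma ambient_isotopic_vertical:
  fixes c :: "'u::metric_space \<Rightarrow> complex" and \<zeta> \<zeta>' :: "'u \<Rightarrow> real"
  assumes X: "compact X" "X \<noteq> {}"
    and cont: "continuous_on X c" "continuous_on X \<zeta>" "continuous_on X \<zeta>'"
    and D: "compact D" "D \<subseteq> X \<times> X"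
    and near: "\<And>u v. u \<in> X \<Longrightarrow> v \<in> X \<Longrightarrow> (u, v) \<notin> D \<Longrightarrow>
      \<bar>\<zeta> u - \<zeta> v\<bar> \<le> C * norm (c u - c v) \<and> \<bar>\<zeta>' u - \<zeta>' v\<bar> \<le> C * norm (c u - c v)"
    and far: "\<And>u v. (u, v) \<in> D \<Longrightarrow> c u = c v \<Longrightarrow>
      \<zeta> u < \<zeta> v \<and> \<zeta>' u < \<zeta>' v \<or> \<zeta> v < \<zeta> u \<and> \<zeta>' v < \<zeta>' u"
  shows "ambient_isotopic ((\<lambda>u. (c u, \<zeta> u)) ` X) ((\<lambda>u. (c u, \<zeta>' u)) ` X)"
proof -
  \<comment> \<open>For \<open>n\<close> at least 1 this is concave and increasing, with slope
    \<open>n\<close> below 0 and slope \<open>1 / n\<close> above. Large \<open>n\<close> makes a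
    cone fall steeply downwards and rise hardly at all upwards.\<close>
  define m where "m n t = min (t / n) (n * t)" for n t :: real
  have m_le: "m n t \<le> t / n" "m n t \<le> n * t" for n t
    by (auto simp: m_def)
  have m_add: "m n (t + s) \<ge> m n t + s / n" if "n \<ge> 1" "s \<ge> 0" for n t s
  proof -
    have "s / n \<le> s * 1" using that by (simp add: divide_le_eq mult_le_cancel_left1)
    also have "\<dots> \<le> s * n" using that by (intro mult_left_mono) auto
    finally show ?thesis by (auto simp: m_def min_def algebra_simps add_divide_distrib)
  qed
  have m_mono: "m n t \<le> m n t'" if "n \<ge> 1" "t \<le> t'" for n t t'
    unfolding m_def using that by (intro min.mono divide_right_mono mult_left_mono) auto
  have m_lip: "m n t \<le> m n t' + n * \<bar>t - t'\<bar>" if "n \<ge> 1" for n t t'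
  proof -
    define s where "s = \<bar>t - t'\<bar>"
    have "s / n \<le> s * 1" using that by (simp add: s_def divide_le_eq mult_le_cancel_left1)
    also have "\<dots> \<le> s * n" using that by (intro mult_left_mono) (auto simp: s_def)
    finally have "m n (t' + s) \<le> m n t' + n * s"
      by (simp add: m_def algebra_simps add_divide_distrib min_le_iff_disj min_def)
    moreover have "m n t \<le> m n (t' + s)"
      by (rule m_mono[OF that]) (auto simp: s_def)
    ultimately show ?thesis by (simp add: s_def)
  qed
  \<comment> \<open>If no steepness worked, there would be violating pairs with \<open>n\<close>
    tending to infinity. Taking \<open>n\<close> above \<open>2 * C\<close> forces them into the
    compact set \<open>D\<close> by \<open>near\<close>; they accumulate at a double point, where
    the common order in \<open>far\<close> is contradicted.\<close>
  have "\<exists>n\<ge>1. \<forall>u\<in>X. \<forall>v\<in>X. \<zeta>' v + m n (\<zeta> u - \<zeta> v) - n * norm (c u - c v) \<le> \<zeta>' u"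
  proof (rule ccontr)
    assume contra: "\<not> ?thesis"
    define N where "N k = \<bar>2 * C\<bar> + 1 + real k" for k
    have N1: "N k \<ge> 1" and Npos: "N k > 0" for k by (auto simp: N_def)
    have "\<exists>w. fst w \<in> X \<and> snd w \<in> X \<and> \<zeta>' (snd w) + m (N k) (\<zeta> (fst w) - \<zeta> (snd w))
        - N k * norm (c (fst w) - c (snd w)) > \<zeta>' (fst w)" for k
      using contra N1[of k] unfolding not_le by (metis fst_conv snd_conv not_le)
    then obtain f where f: "\<And>k. fst (f k) \<in> X \<and> snd (f k) \<in> X \<and>
        \<zeta>' (snd (f k)) + m (N k) (\<zeta> (fst (f k)) - \<zeta> (snd (f k)))
          - N k * norm (c (fst (f k)) - c (snd (f k))) > \<zeta>' (fst (f k))"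
      by metis
    have fD: "f k \<in> D" for k
    proof (rule ccontr)
      let ?u = "fst (f k)" and ?v = "snd (f k)"
      assume "f k \<notin> D"
      then have *: "\<bar>\<zeta> ?u - \<zeta> ?v\<bar> \<le> C * norm (c ?u - c ?v)" "\<bar>\<zeta>' ?u - \<zeta>' ?v\<bar> \<le> C * norm (c ?u - c ?v)"
        using near[of ?u ?v] f[of k] by auto
      have "m (N k) (\<zeta> ?u - \<zeta> ?v) \<le> \<bar>\<zeta> ?u - \<zeta> ?v\<bar> / N k"
        using m_le(1)[of "N k" "\<zeta> ?u - \<zeta> ?v"] Npos[of k] by (meson abs_ge_self divide_right_mono less_imp_le order_trans)
      also have "\<dots> \<le> \<bar>\<zeta> ?u - \<zeta> ?v\<bar>"
        using N1[of k] by (simp add: divide_le_eq mult_le_cancel_left1)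
      finally have "N k * norm (c ?u - c ?v) < 2 * C * norm (c ?u - c ?v)"
        using f[of k] * by linarith
      then have "N k < 2 * C"
        by (meson mult_right_mono norm_ge_zero not_less)
      then show False by (simp add: N_def)
    qed
    obtain l r where l: "l \<in> D" and r: "strict_mono r" and lim: "(f \<circ> r) \<longlonglongrightarrow> l"
      using D(1) fD unfolding compact_def by metis
    obtain u v where uv: "l = (u, v)" by (cases l)
    have uvX: "u \<in> X" "v \<in> X" using l uv D(2) by auto
    have frX: "fst (f (r k)) \<in> X" "snd (f (r k)) \<in> X" for k using f by auto
    have lu: "(\<lambda>k. fst (f (r k))) \<longlonglongrightarrow> u" and lv: "(\<lambda>k. snd (f (r k))) \<longlonglongrightarrow> v"
      using tendsto_fst[OF lim] tendsto_snd[OF lim] by (auto simp: uv o_def)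
    have lims: "(\<lambda>k. g (fst (f (r k)))) \<longlonglongrightarrow> g u" "(\<lambda>k. g (snd (f (r k)))) \<longlonglongrightarrow> g v"
      if "continuous_on X g" for g :: "'u \<Rightarrow> 'z::topological_space"
      using continuous_on_tendsto_compose[OF that lu uvX(1)] continuous_on_tendsto_compose[OF that lv uvX(2)] frX
      by auto
    note lc = lims[OF cont(1)] and l\<zeta> = lims[OF cont(2)] and l\<zeta>' = lims[OF cont(3)]
    define \<tau> where "\<tau> k = \<zeta> (fst (f (r k))) - \<zeta> (snd (f (r k)))" for k
    define \<delta> where "\<delta> k = norm (c (fst (f (r k))) - c (snd (f (r k))))" for k
    define \<gamma> where "\<gamma> k = \<zeta>' (snd (f (r k))) - \<zeta>' (fst (f (r k)))" for k
    define n where "n k = N (r k)" for k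
    have \<tau>: "\<tau> \<longlonglongrightarrow> \<zeta> u - \<zeta> v" and \<delta>: "\<delta> \<longlonglongrightarrow> norm (c u - c v)" and \<gamma>: "\<gamma> \<longlonglongrightarrow> \<zeta>' v - \<zeta>' u"
      unfolding \<tau>_def \<delta>_def \<gamma>_def by (intro tendsto_intros lc l\<zeta> l\<zeta>')+
    have main: "\<gamma> k + m (n k) (\<tau> k) > n k * \<delta> k" for k
      using f[of "r k"] by (simp add: \<tau>_def \<delta>_def \<gamma>_def n_def)
    have \<delta>0: "\<delta> k \<ge> 0" for k by (simp add: \<delta>_def)
    have n1: "n k \<ge> 1" "n k > 0" for k by (auto simp: n_def N1 Npos)
    have "filterlim (\<lambda>k. real (r k)) at_top sequentially"
      by (rule filterlim_compose[OF filterlim_real_sequentially filterlim_subseq[OF r]])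
    then have n_lim: "filterlim n at_top sequentially"
      unfolding n_def N_def by (intro filterlim_tendsto_add_at_top[OF tendsto_const] filterlim_ident)
    have inv_n: "(\<lambda>k. inverse (n k)) \<longlonglongrightarrow> 0"
      by (rule tendsto_inverse_0_at_top[OF n_lim])
    have "\<delta> k \<le> (\<gamma> k + \<tau> k * inverse (n k)) * inverse (n k)" for k
    proof -
      have "n k * \<delta> k \<le> \<gamma> k + \<tau> k * inverse (n k)"
        using main[of k] m_le(1)[of "n k" "\<tau> k"] by (simp add: divide_inverse)
      then show ?thesis
        using n1(2)[of k] by (metis divide_inverse mult.commute pos_le_divide_eq)
    qed
    moreover have "(\<lambda>k. (\<gamma> k + \<tau> k * inverse (n k)) * inverse (n k)) \<longlonglongrightarrow> (\<zeta>' v - \<zeta>' u + (\<zeta> u - \<zeta> v) * 0) * 0"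
      by (intro tendsto_intros \<gamma> \<tau> inv_n)
    ultimately have "norm (c u - c v) \<le> 0"
      using LIMSEQ_le[OF \<delta>, of _ 0] by simp
    then have cuv: "c u = c v" by simp
    \<comment> \<open>If \<open>u\<close> is the lower point, the slope \<open>n\<close> drives
      \<open>m\<close> to minus infinity. If it is the upper one, the slope \<open>1 / n\<close>
      makes \<open>m\<close> vanish in the limit, and the strict gap between the new heights
      decides.\<close>
    consider "\<zeta> u < \<zeta> v" | "\<zeta>' v < \<zeta>' u" "\<zeta> v < \<zeta> u"
      using far[of u v] l uv cuv by auto
    then show False
    proof cases
      case 1
      have "filterlim (\<lambda>k. - \<gamma> k + - \<tau> k * n k) at_top sequentially"
        by (rule filterlim_tendsto_add_at_top[OF tendsto_minus[OF \<gamma>]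
            filterlim_tendsto_pos_mult_at_top[OF tendsto_minus[OF \<tau>] _ n_lim]]) (use 1 in simp)
      then have "\<forall>\<^sub>F k in sequentially. 0 < - \<gamma> k + - \<tau> k * n k"
        unfolding filterlim_at_top_dense by blast
      then have "\<forall>\<^sub>F k in sequentially. \<gamma> k + \<tau> k * n k < 0"
        by (rule eventually_mono) linarith
      then obtain k where "\<gamma> k + \<tau> k * n k < 0"
        by (auto simp: eventually_sequentially)
      then show False
        using main[of k] m_le(2)[of "n k" "\<tau> k"] mult_nonneg_nonneg[OF less_imp_le[OF n1(2)] \<delta>0, of k k]
        by (simp add: mult.commute)
    next
      case 2
      have "(\<lambda>k. \<gamma> k + \<tau> k * inverse (n k)) \<longlonglongrightarrow> (\<zeta>' v - \<zeta>' u) + (\<zeta> u - \<zeta> v) * 0"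
        by (intro tendsto_intros \<gamma> \<tau> inv_n)
      then have "\<forall>\<^sub>F k in sequentially. \<gamma> k + \<tau> k * inverse (n k) < 0"
        by (rule order_tendstoD) (use 2 in simp)
      then obtain k where "\<gamma> k + \<tau> k * inverse (n k) < 0"
        by (auto simp: eventually_sequentially)
      then show False
        using main[of k] m_le(1)[of "n k" "\<tau> k"] mult_nonneg_nonneg[OF less_imp_le[OF n1(2)] \<delta>0, of k k]
        by (simp add: divide_inverse)
    qed
  qed
  then obtain n where n: "n \<ge> 1"
    and dom: "\<And>u v. u \<in> X \<Longrightarrow> v \<in> X \<Longrightarrow> \<zeta>' v + m n (\<zeta> u - \<zeta> v) - n * norm (c u - c v) \<le> \<zeta>' u"
    by blast
  \<comment> \<open>\<open>h u\<close> is the cone with apex at the new height over the point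
    \<open>u\<close> of the link. By \<open>dom\<close>, no other cone exceeds it at that point, so
    the envelope \<open>F\<close> takes the prescribed values.\<close>
  define h where "h u = (\<lambda>(x, z). \<zeta>' u + m n (z - \<zeta> u) - n * norm (x - c u))" for u
  define F where "F w = (SUP u\<in>X. h u w)" for w
  have bdd: "bdd_above ((\<lambda>u. h u w) ` X)" for w
  proof -
    have "continuous_on X (\<lambda>u. \<zeta>' u + min ((snd w - \<zeta> u) / n) (n * (snd w - \<zeta> u)) - n * norm (fst w - c u))"
      by (intro continuous_intros cont) (use n in auto)
    then have "continuous_on X (\<lambda>u. h u w)"
      by (simp add: h_def m_def case_prod_unfold)
    then show ?thesis
      by (intro bounded_imp_bdd_above compact_imp_bounded compact_continuous_image X(1))
  qed
  have contF: "continuous_on UNIV F"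
    unfolding F_def
  proof (rule continuous_on_Sup_lipschitz[where L = "2 * n", OF X(2) bdd])
    fix u and w w' :: "complex \<times> real"
    obtain x z x' z' where w: "w = (x, z)" "w' = (x', z')" by (metis surj_pair)
    have "\<bar>z - z'\<bar> \<le> dist w w'" "dist x x' \<le> dist w w'"
      using dist_snd_le[of w w'] dist_fst_le[of w w'] by (auto simp: w dist_real_def)
    moreover have "norm (x' - c u) \<le> norm (x - c u) + dist x x'"
      using norm_triangle_ineq[of "x - c u" "x' - x"] by (simp add: dist_norm norm_minus_commute)
    ultimately have "n * \<bar>z - z'\<bar> \<le> n * dist w w'" "n * norm (x' - c u) \<le> n * (norm (x - c u) + dist w w')"
      using n by (auto intro!: mult_left_mono)
    then show "h u w \<le> h u w' + 2 * n * dist w w'"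
      using m_lip[OF n, of "z - \<zeta> u" "z' - \<zeta> u"] by (simp add: h_def w algebra_simps)
  qed
  have incrF: "F (x, z + s) \<ge> F (x, z) + s / n" if "s \<ge> 0" for x z s
  proof -
    have "F (x, z) \<le> F (x, z + s) - s / n"
      unfolding F_def[of "(x, z)"]
    proof (rule cSUP_least[OF X(2)])
      fix u assume u: "u \<in> X"
      have "h u (x, z) + s / n \<le> h u (x, z + s)"
        using m_add[OF n that, of "z - \<zeta> u"] by (simp add: h_def algebra_simps)
      then show "h u (x, z) \<le> F (x, z + s) - s / n"
        using cSUP_upper[OF u bdd[of "(x, z + s)"]] by (simp add: F_def)
    qed
    then show ?thesis by simp
  qed
  have Fval: "F (c u, \<zeta> u) = \<zeta>' u" if u: "u \<in> X" for u
  proof (rule antisym)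
    show "F (c u, \<zeta> u) \<le> \<zeta>' u"
      unfolding F_def using dom[OF u] by (intro cSUP_least[OF X(2)]) (simp add: h_def)
    show "\<zeta>' u \<le> F (c u, \<zeta> u)"
      using cSUP_upper[OF u bdd[of "(c u, \<zeta> u)"]] by (simp add: F_def h_def m_def)
  qed
  \<comment> \<open>A convex combination of the identity and \<open>F\<close> still grows at rate at
    least \<open>1 / n\<close> on every vertical line, so each stage is bijective.\<close>
  define H where "H t = (\<lambda>(x, z). (x, (1 - t) * z + t * F (x, z)))" for t
  show ?thesis
  proof (rule ambient_isotopicI[of H])
    have "continuous_on ({0..1} \<times> UNIV) (\<lambda>w. F (snd w :: complex \<times> real))"
      by (rule continuous_on_compose2[OF contF]) (auto intro!: continuous_intros)
    then have "continuous_on ({0..1} \<times> UNIV)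
        (\<lambda>w. (fst (snd w), (1 - fst w) * snd (snd w) + fst w * F (snd w)) :: complex \<times> real)"
      by (intro continuous_intros)
    then show "continuous_on ({0..1} \<times> UNIV) (\<lambda>(t, x). H t x)"
      by (simp add: H_def case_prod_unfold)
  next
    fix t :: real assume t: "t \<in> {0..1}"
    define G where "G x z = (1 - t) * z + t * F (x, z)" for x z
    have "bij (\<lambda>(x, z). (x, G x z))"
    proof (rule bij_increasing_on_lines[where \<kappa> = "1 / n"])
      show "continuous_on UNIV (G x)" for x
        unfolding G_def
        by (intro continuous_intros continuous_on_compose2[OF contF]) auto
      show "G x z + 1 / n * s \<le> G x (z + s)" if "s \<ge> 0" for x z s
      proof -
        define r where "r = s / n"
        have "t * (F (x, z) + r) \<le> t * F (x, z + s)"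
          using t incrF[OF that] by (intro mult_left_mono) (auto simp: r_def)
        moreover have "r \<le> s"
          using n that by (simp add: r_def divide_le_eq mult_le_cancel_left1)
        then have "(1 - t) * r \<le> (1 - t) * s"
          using t by (intro mult_left_mono) auto
        moreover have "1 / n * s = r" by (simp add: r_def)
        ultimately show ?thesis by (simp only: G_def) (simp add: algebra_simps)
      qed
    qed (use n in auto)
    then show "bij (H t)" by (simp add: H_def G_def)
  next
    show "H 1 ` (\<lambda>u. (c u, \<zeta> u)) ` X = (\<lambda>u. (c u, \<zeta>' u)) ` X"
      using Fval by (auto simp: H_def image_image)
  qed (auto simp: H_def)
qed

section \<open>Knots with one maximum and one minimum\<close>


text \<open>The multiplier is given by a logarithm so that it can be deformed to 1 through the
  nonzero numbers \<open>exp (- t g)\<close>, keeping every stage invertible.\<close>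

lemma ambient_isotopic_horizontal:
  fixes M g :: "real \<Rightarrow> complex"
  assumes "continuous_on UNIV M" and "continuous_on UNIV g"
  shows "ambient_isotopic K ((\<lambda>(x, z). ((x - M z) * exp (- g z), z)) ` K)"
proof (rule ambient_isotopicI)
  let ?H = "\<lambda>(t::real) (x, z). ((x - of_real t * M z) * exp (- (of_real t * g z)), z)"
  have "continuous_on ({0..1} \<times> UNIV) (\<lambda>w :: real \<times> complex \<times> real.
      ((fst (snd w) - of_real (fst w) * M (snd (snd w))) * exp (- (of_real (fst w) * g (snd (snd w)))), snd (snd w)))"
    by (intro continuous_intros continuous_on_compose2[OF assms(1)] continuous_on_compose2[OF assms(2)]) auto
  then show "continuous_on ({0..1} \<times> UNIV) (\<lambda>(t, w). ?H t w)"
    by (simp add: case_prod_unfold)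
  show "bij (?H t)" for t
    by (rule bij_betw_byWitness[where f' = "\<lambda>(x, z). (x * exp (of_real t * g z) + of_real t * M z, z)"])
      (auto simp: exp_minus field_simps)
qed auto

text \<open>A rotation about the real axis; it lays a circle standing in the plane of real part and
  height down into the horizontal plane.\<close>

lemma ambient_isotopic_quarter_turn:
  "ambient_isotopic K ((\<lambda>(x, z). (Complex (Re x) z, - Im x)) ` K)"
proof (rule ambient_isotopicI)
  let ?H = "\<lambda>t (x, z). (Complex (Re x) (cos (t * pi / 2) * Im x + sin (t * pi / 2) * z),
    cos (t * pi / 2) * z - sin (t * pi / 2) * Im x)"
  have "continuous_on ({0..1} \<times> UNIV) (\<lambda>w :: real \<times> complex \<times> real.
      (Complex (Re (fst (snd w))) (cos (fst w * pi / 2) * Im (fst (snd w)) + sin (fst w * pi / 2) * snd (snd w)),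
       cos (fst w * pi / 2) * snd (snd w) - sin (fst w * pi / 2) * Im (fst (snd w))))"
    unfolding Complex_eq by (intro continuous_intros) auto
  then show "continuous_on ({0..1} \<times> UNIV) (\<lambda>(t, w). ?H t w)"
    by (simp add: case_prod_unfold)
  show "bij (?H t)" for t
  proof -
    define C S where "C = cos (t * pi / 2)" and "S = sin (t * pi / 2)"
    have CS: "C * C + S * S = 1"
      using sin_cos_squared_add3[of "t * pi / 2"] by (simp add: C_def S_def)
    have [simp]: "C * (C * v + S * z) - S * (C * z - S * v) = v"
      "C * (C * z - S * v) + S * (C * v + S * z) = z"
      "C * (C * v - S * z) + S * (C * z + S * v) = v"
      "C * (C * z + S * v) - S * (C * v - S * z) = z" for v z
      using CS by algebra+
    show ?thesis
      unfolding C_def[symmetric] S_def[symmetric]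
      by (rule bij_betw_byWitness[where f' = "\<lambda>(x, z). (Complex (Re x) (C * Im x - S * z), C * z + S * Im x)"]) auto
  qed
  show "?H 0 x = x" for x by (auto simp: case_prod_unfold)
qed (auto simp: image_iff case_prod_unfold)

text \<open>After centring at the midpoint, the two points at height \<open>- cos \<phi>\<close> are
  plus and minus \<open>sin \<phi> * e \<phi> / 2\<close>. Since \<open>e / 2\<close> has no zero on
  the interval, it has a continuous logarithm, and dividing by it leaves an upright round
  circle.\<close>

lemma trivial_knot_two_arcs:
  fixes a b e :: "real \<Rightarrow> complex"
  assumes cont: "continuous_on {0..pi} a" "continuous_on {0..pi} b" "continuous_on {0..pi} e"
    and nz: "\<And>\<phi>. \<phi> \<in> {0..pi} \<Longrightarrow> e \<phi> \<noteq> 0"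
    and diff: "\<And>\<phi>. \<phi> \<in> {0..pi} \<Longrightarrow> b \<phi> - a \<phi> = of_real (sin \<phi>) * e \<phi>"
  shows "trivial_knot ((\<lambda>\<phi>. (b \<phi>, - cos \<phi>)) ` {0..pi} \<union> (\<lambda>\<phi>. (a \<phi>, - cos \<phi>)) ` {0..pi})"
proof -
  have "continuous_on {0..pi} (\<lambda>\<phi>. e \<phi> / 2)" by (intro continuous_intros cont) auto
  then obtain l where l: "continuous_on {0..pi} l" "\<And>\<phi>. \<phi> \<in> {0..pi} \<Longrightarrow> e \<phi> / 2 = exp (l \<phi>)"
    by (rule continuous_logarithm_on_contractible) (use nz in \<open>auto intro: convex_imp_contractible\<close>)
  \<comment> \<open>Recovers the phase from the height. The clamp extends it continuously to all
    heights, since the isotopy must also act above and below the knot.\<close>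
  define \<Phi> where "\<Phi> z = arccos (- max (-1) (min 1 z))" for z
  have \<Phi>cos: "\<Phi> (- cos \<phi>) = \<phi>" if "\<phi> \<in> {0..pi}" for \<phi>
    using that by (simp add: \<Phi>_def min_absorb2 max_absorb2 arccos_cos)
  have \<Phi>cont: "continuous_on UNIV \<Phi>"
    unfolding \<Phi>_def by (intro continuous_intros) (auto simp: min_def max_def)
  have \<Phi>range: "\<Phi> z \<in> {0..pi}" for z
    unfolding \<Phi>_def by (auto intro!: arccos_lbound arccos_ubound)
  have comp: "continuous_on UNIV (\<lambda>z. f (\<Phi> z))" if "continuous_on {0..pi} f" for f :: "real \<Rightarrow> complex"
    using continuous_on_compose2[OF that \<Phi>cont] \<Phi>range by blast
  define M where "M z = (a (\<Phi> z) + b (\<Phi> z)) / 2" for z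
  define K where "K = (\<lambda>\<phi>. (b \<phi>, - cos \<phi>)) ` {0..pi} \<union> (\<lambda>\<phi>. (a \<phi>, - cos \<phi>)) ` {0..pi}"
  define L where "L = (\<lambda>\<phi>. (complex_of_real (sin \<phi>), - cos \<phi>)) ` {0..pi} \<union>
    (\<lambda>\<phi>. (complex_of_real (- sin \<phi>), - cos \<phi>)) ` {0..pi}"
  have ba: "(b \<phi> - M (- cos \<phi>)) * exp (- l (\<Phi> (- cos \<phi>))) = of_real (sin \<phi>)"
    "(a \<phi> - M (- cos \<phi>)) * exp (- l (\<Phi> (- cos \<phi>))) = of_real (- sin \<phi>)" if \<phi>: "\<phi> \<in> {0..pi}" for \<phi>
  proof -
    have "b \<phi> - M (- cos \<phi>) = (b \<phi> - a \<phi>) / 2" "a \<phi> - M (- cos \<phi>) = - ((b \<phi> - a \<phi>) / 2)"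
      by (simp_all add: M_def \<Phi>cos[OF \<phi>] field_simps)
    moreover have "(b \<phi> - a \<phi>) / 2 = of_real (sin \<phi>) * exp (l \<phi>)"
      using diff[OF \<phi>] l(2)[OF \<phi>] by simp
    ultimately show "(b \<phi> - M (- cos \<phi>)) * exp (- l (\<Phi> (- cos \<phi>))) = of_real (sin \<phi>)"
      "(a \<phi> - M (- cos \<phi>)) * exp (- l (\<Phi> (- cos \<phi>))) = of_real (- sin \<phi>)"
      by (simp_all only: \<Phi>cos[OF \<phi>] exp_minus) (simp_all add: field_simps)
  qed
  have "(\<lambda>(x, z). ((x - M z) * exp (- l (\<Phi> z)), z)) ` K = L"
    unfolding K_def L_def image_Un image_image prod.case
    by (intro arg_cong2[of _ _ _ _ "(\<union>)"] image_cong refl) (simp_all only: ba)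
  moreover have "ambient_isotopic K ((\<lambda>(x, z). ((x - M z) * exp (- l (\<Phi> z)), z)) ` K)"
    unfolding M_def
    by (intro ambient_isotopic_horizontal comp[of l] l(1) continuous_intros comp cont) auto
  ultimately have KL: "ambient_isotopic K L" by simp
  have "(\<lambda>(x, z). (Complex (Re x) z, - Im x)) ` L = sphere 0 1 \<times> {0}"
  proof (intro equalityI subsetI)
    fix w assume "w \<in> (\<lambda>(x, z). (Complex (Re x) z, - Im x)) ` L"
    then show "w \<in> sphere 0 1 \<times> {0}"
      by (auto simp: L_def cmod_def)
  next
    fix w :: "complex \<times> real" assume "w \<in> sphere 0 1 \<times> {0}"
    then obtain x where w: "w = (x, 0)" "(Re x)\<^sup>2 + (Im x)\<^sup>2 = 1"
      by (auto simp: cmod_def)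
    have "(Im x)\<^sup>2 \<le> 1\<^sup>2" using w(2) zero_le_power2[of "Re x"] unfolding one_power2 by linarith
    then have im: "\<bar>Im x\<bar> \<le> 1" using abs_le_square_iff[of "Im x" 1] by simp
    define \<phi> where "\<phi> = arccos (- Im x)"
    have \<phi>: "\<phi> \<in> {0..pi}" "cos \<phi> = - Im x"
      using im by (auto simp: \<phi>_def intro!: arccos_lbound arccos_ubound)
    have "sin \<phi> = sqrt (1 - (Im x)\<^sup>2)"
      using sin_arccos[of "- Im x"] im by (simp add: \<phi>_def)
    then have "sin \<phi> = \<bar>Re x\<bar>" using w(2)
      by (metis add_diff_cancel_right' real_sqrt_abs)
    then have "Re x = sin \<phi> \<or> Re x = - sin \<phi>" by linarith
    then have "(of_real (Re x), Im x) \<in> L"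
      using \<phi> unfolding L_def by (auto simp: image_iff intro!: bexI[of _ \<phi>])
    then show "w \<in> (\<lambda>(x, z). (Complex (Re x) z, - Im x)) ` L"
      by (rule rev_image_eqI) (simp add: w complex_eq_iff)
  qed
  then have "ambient_isotopic L (sphere 0 1 \<times> {0})"
    using ambient_isotopic_quarter_turn[of L] by (simp only:)
  with KL show ?thesis
    unfolding trivial_knot_def K_def by (rule ambient_isotopic_trans)
qed

text \<open>L'Hopital's rule at a common zero, for a complex numerator and one-sided limits: both
  difference quotients converge.\<close>

lemma tendsto_quotient_of_derivatives:
  fixes f :: "real \<Rightarrow> complex"
  assumes f: "(f has_vector_derivative f') (at x within S)" "f x = 0"
    and g: "(g has_real_derivative g') (at x within S)" "g x = 0" "g' \<noteq> 0"
  shows "((\<lambda>y. f y / of_real (g y)) \<longlongrightarrow> f' / of_real g') (at x within S)"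
proof -
  have F: "((\<lambda>y. f y /\<^sub>R (y - x)) \<longlongrightarrow> f') (at x within S)"
  proof -
    have "((\<lambda>y. norm (f y - (y - x) *\<^sub>R f') / norm (y - x)) \<longlongrightarrow> 0) (at x within S)"
      using f by (simp add: has_vector_derivative_def has_derivative_iff_norm)
    then have "((\<lambda>y. norm (f y /\<^sub>R (y - x) - f')) \<longlongrightarrow> 0) (at x within S)"
    proof (rule Lim_transform_eventually)
      have "norm (f y - (y - x) *\<^sub>R f') / norm (y - x) = norm (f y /\<^sub>R (y - x) - f')" if "y \<noteq> x" for y
      proof -
        have "f y /\<^sub>R (y - x) - f' = (f y - (y - x) *\<^sub>R f') /\<^sub>R (y - x)"
          using that by (simp add: scaleR_diff_right)
        then show ?thesis by (simp add: divide_inverse mult.commute)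
      qed
      then show "\<forall>\<^sub>F y in at x within S. norm (f y - (y - x) *\<^sub>R f') / norm (y - x) = norm (f y /\<^sub>R (y - x) - f')"
        by (auto simp: eventually_at_filter)
    qed
    then show ?thesis
      by (rule LIM_zero_cancel[OF tendsto_norm_zero_cancel])
  qed
  have G: "((\<lambda>y. g y / (y - x)) \<longlongrightarrow> g') (at x within S)"
    using g by (simp add: has_field_derivative_iff)
  have "((\<lambda>y. (f y /\<^sub>R (y - x)) / of_real (g y / (y - x))) \<longlongrightarrow> f' / of_real g') (at x within S)"
    by (intro tendsto_divide F tendsto_of_real G) (use g in simp)
  moreover have "(f y /\<^sub>R (y - x)) / of_real (g y / (y - x)) = f y / of_real (g y)" if "y \<noteq> x" for y
    using that by (cases "g y = 0") (simp_all add: scaleR_conv_of_real divide_simps del: of_real_diff)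
  ultimately show ?thesis
    by (elim Lim_transform_eventually) (auto simp: eventually_at_filter)
qed

text \<open>Like the sine, \<open>d\<close> has simple zeros at both ends. The quotient thus extends
  by \<open>l0\<close> at 0 and by \<open>- l1\<close> at \<open>pi\<close>, where the derivative of
  the sine is -1, and it has no zeros.\<close>

lemma factor_sin:
  fixes d :: "real \<Rightarrow> complex"
  assumes cont: "continuous_on {0..pi} d"
    and nz: "\<And>\<phi>. 0 < \<phi> \<Longrightarrow> \<phi> < pi \<Longrightarrow> d \<phi> \<noteq> 0"
    and d0: "d 0 = 0" "(d has_vector_derivative l0) (at 0 within {0..pi})" "l0 \<noteq> 0"
    and d1: "d pi = 0" "(d has_vector_derivative l1) (at pi within {0..pi})" "l1 \<noteq> 0"
  obtains e where "continuous_on {0..pi} e" "\<And>\<phi>. \<phi> \<in> {0..pi} \<Longrightarrow> e \<phi> \<noteq> 0"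
    "\<And>\<phi>. \<phi> \<in> {0..pi} \<Longrightarrow> d \<phi> = of_real (sin \<phi>) * e \<phi>"
proof -
  let ?e = "\<lambda>\<phi>. if \<phi> = 0 then l0 else if \<phi> = pi then - l1 else d \<phi> / of_real (sin \<phi>)"
  have sin_nz: "sin \<phi> \<noteq> 0" if "0 < \<phi>" "\<phi> < pi" for \<phi>
    using sin_gt_zero[OF that] by simp
  have e_nz: "?e \<phi> \<noteq> 0" if "\<phi> \<in> {0..pi}" for \<phi>
    using that d0 d1 nz[of \<phi>] sin_nz[of \<phi>] by auto
  have e_eq: "d \<phi> = of_real (sin \<phi>) * ?e \<phi>" if "\<phi> \<in> {0..pi}" for \<phi>
    using that d0 d1 sin_nz[of \<phi>] by auto
  have ends: "(?e \<longlongrightarrow> l) (at x within {0..pi})"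
    if l: "((\<lambda>\<phi>. d \<phi> / of_real (sin \<phi>)) \<longlongrightarrow> l) (at x within {0..pi})" and x: "x = 0 \<or> x = pi" for x l
  proof (rule Lim_transform_within[OF l, of pi])
    show "d y / of_real (sin y) = ?e y" if "y \<in> {0..pi}" "0 < dist y x" "dist y x < pi" for y
      using that x by (auto simp: dist_real_def)
  qed simp
  have "continuous_on {0..pi} ?e"
    unfolding continuous_on_def
  proof
    fix x assume x: "x \<in> {0..pi}"
    consider "x = 0" | "x = pi" | "0 < x" "x < pi" using x by force
    then show "(?e \<longlongrightarrow> ?e x) (at x within {0..pi})"
    proof cases
      case 1
      have "(sin has_real_derivative 1) (at 0 within {0..pi})"
        by (auto intro!: derivative_eq_intros)
      from tendsto_quotient_of_derivatives[OF d0(2,1) this] show ?thesis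
        using ends[of l0 x] 1 by auto
    next
      case 2
      have "(sin has_real_derivative -1) (at pi within {0..pi})"
        by (auto intro!: derivative_eq_intros)
      from tendsto_quotient_of_derivatives[OF d1(2,1) this] show ?thesis
        using ends[of "- l1" x] 2 by auto
    next
      case 3
      have "((\<lambda>\<phi>. d \<phi> / of_real (sin \<phi>)) \<longlongrightarrow> d x / of_real (sin x)) (at x within {0..pi})"
        using cont x sin_nz[OF 3] by (intro tendsto_intros) (auto simp: continuous_on_def)
      then have "(?e \<longlongrightarrow> d x / of_real (sin x)) (at x within {0..pi})"
      proof (rule Lim_transform_within[where d = "min x (pi - x)"])
        show "d y / of_real (sin y) = ?e y" if "y \<in> {0..pi}" "0 < dist y x" "dist y x < min x (pi - x)" for y
          using that by (auto simp: dist_real_def)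
      qed (use 3 in auto)
      then show ?thesis using 3 by auto
    qed
  qed
  then show thesis
    by (rule that[of ?e]) (fact e_nz, fact e_eq)
qed

section \<open>Ascending curves around an axis\<close>


lemma abs_diff_cos_le: "\<bar>cos s - cos t\<bar> \<le> \<bar>s - t :: real\<bar>"
proof -
  have "\<bar>cos s - cos t\<bar> = 2 * (\<bar>sin ((s + t) / 2)\<bar> * \<bar>sin ((t - s) / 2)\<bar>)"
    by (simp add: cos_diff_cos abs_mult)
  also have "\<dots> \<le> 2 * (1 * \<bar>(t - s) / 2\<bar>)"
    by (intro mult_left_mono mult_mono abs_sin_le_one abs_sin_x_le_abs_x) auto
  finally show ?thesis by simp
qed

lemma norm_diff_polar_power2:
  "(norm (of_real r * cis a - of_real r' * cis b))\<^sup>2 = r\<^sup>2 + r'\<^sup>2 - 2 * (r * r') * cos (a - b)"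
proof -
  have "(r * cos a - r' * cos b)\<^sup>2 + (r * sin a - r' * sin b)\<^sup>2 =
      r\<^sup>2 + r'\<^sup>2 - 2 * (r * r') * (cos a * cos b + sin a * sin b)"
    using sin_cos_squared_add[of a] sin_cos_squared_add[of b] by algebra
  then show ?thesis by (simp add: cmod_power2 cos_diff)
qed

lemma norm_diff_cis_le: "norm (cis s - cis t) \<le> \<bar>s - t\<bar>"
proof -
  have "(norm (cis s - cis t))\<^sup>2 = 2 - 2 * cos (s - t)"
    using norm_diff_polar_power2[of 1 s 1 t] by simp
  also have "\<dots> = (2 * sin ((s - t) / 2))\<^sup>2"
  proof -
    have "2 * ((s - t) / 2) = s - t" by simp
    then have "cos (s - t) = 1 - 2 * (sin ((s - t) / 2))\<^sup>2"
      by (metis cos_double_sin)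
    then show ?thesis by (simp add: power_mult_distrib)
  qed
  also have "\<dots> \<le> (s - t)\<^sup>2"
    using abs_sin_x_le_abs_x[of "(s - t) / 2"] unfolding abs_le_square_iff[symmetric] by (simp add: abs_mult)
  finally have "(norm (cis s - cis t))\<^sup>2 \<le> \<bar>s - t\<bar>\<^sup>2" by simp
  then show ?thesis by (rule power2_le_imp_le) simp
qed

lemma sin_ge_half:
  fixes x :: real
  assumes "0 \<le> x" "x \<le> pi / 3"
  shows "x / 2 \<le> sin x"
proof -
  have "sin 0 - 0 / 2 \<le> sin x - x / 2"
  proof (rule DERIV_nonneg_imp_nondecreasing[OF assms(1)])
    fix y assume y: "0 \<le> y" "y \<le> x"
    have "1 / 2 \<le> cos y"
      using cos_monotone_0_pi_le[of y "pi / 3"] y assms cos_60 by simp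
    then show "\<exists>d. ((\<lambda>x. sin x - x / 2) has_real_derivative d) (at y) \<and> 0 \<le> d"
      by (intro exI[of _ "cos y - 1 / 2"]) (auto intro!: derivative_eq_intros)
  qed
  then show ?thesis by simp
qed

text \<open>For radii at least 1 the distance is bounded below by the chord of the unit circle,
  \<open>2 * sin (\<bar>a - b\<bar> / 2)\<close>. The bound on the angle keeps the half angle below
  \<open>pi / 3\<close>, where the sine is at least half its argument.\<close>

lemma norm_diff_polar_ge:
  assumes r: "r \<ge> 1" "r' \<ge> 1" and ab: "\<bar>a - b\<bar> \<le> 2 * pi / 3"
  shows "\<bar>a - b\<bar> / 2 \<le> norm (of_real r * cis a - of_real r' * cis b)"
proof -
  define x where "x = \<bar>a - b\<bar> / 2"
  have "(x / 2)\<^sup>2 \<le> (sin x)\<^sup>2"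
    using ab by (intro power_mono sin_ge_half) (auto simp: x_def)
  then have "x\<^sup>2 \<le> 2 - 2 * (1 - 2 * (sin x)\<^sup>2)"
    by (simp add: power_divide)
  also have "1 - 2 * (sin x)\<^sup>2 = cos (a - b)"
    using cos_double_sin[of x] by (simp add: x_def)
  also have "2 - 2 * cos (a - b) \<le> r\<^sup>2 + r'\<^sup>2 - 2 * (r * r') * cos (a - b)"
  proof -
    have "1 * 1 \<le> r * r'" using r by (intro mult_mono) auto
    then have "(r * r' - 1) * cos (a - b) \<le> (r * r' - 1) * 1"
      by (intro mult_left_mono) auto
    moreover have "0 \<le> r\<^sup>2 + r'\<^sup>2 - 2 * (r * r')"
      using zero_le_power2[of "r - r'"] by (simp add: power2_diff)
    ultimately show ?thesis by (simp add: algebra_simps)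
  qed
  also have "\<dots> = (norm (of_real r * cis a - of_real r' * cis b))\<^sup>2"
    by (rule norm_diff_polar_power2[symmetric])
  finally show ?thesis
    unfolding x_def by (rule power2_le_imp_le) simp
qed

text \<open>
  A closed curve winding \<open>p\<close> times around the axis, with all its double points ascending. The window
  of parameters starts and ends in the middle of the resting arc \<open>R = 1\<close>, \<open>\<zeta> = 0\<close>; along the new
  heights \<open>- cos (\<Phi> u)\<close> the curve rises until \<open>P - 2/3\<close> and then falls along the resting arc.
\<close>

lemma trivial_knot_ascending_curve:
  fixes N p :: nat and R \<zeta> :: "real \<Rightarrow> real"
  defines "P \<equiv> real (p * N)" and "c \<equiv> \<lambda>u. complex_of_real (R u) * cis (2 * pi * u / real N)"
  assumes N: "N \<ge> 1" and p: "p \<ge> 1"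
    and R: "continuous_on UNIV R" "\<And>u. R u \<ge> 1"
    and \<zeta>: "\<And>u v. \<bar>\<zeta> u - \<zeta> v\<bar> \<le> L * \<bar>u - v\<bar>"
    and rest: "\<And>u. u \<in> {-1..0} \<union> {P - 1..P} \<Longrightarrow> R u = 1 \<and> \<zeta> u = 0"
    and asc: "\<And>u v k. - (1/3) \<le> u \<Longrightarrow> u < v \<Longrightarrow> v \<le> P - 1/3 \<Longrightarrow> v - u < P \<Longrightarrow>
      v - u = real k * real N \<Longrightarrow> R u = R v \<Longrightarrow> \<zeta> u < \<zeta> v \<and> v \<le> P - 1"
  shows "trivial_knot ((\<lambda>u. (c u, \<zeta> u)) ` {- (1/3)..P - 1/3})"
proof -
  have P1: "P \<ge> 1"
    using mult_mono[of 1 "real p" 1 "real N"] N p by (simp add: P_def)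
  define W where "W = {- (1/3)..P - 1/3}"
  define \<omega> where "\<omega> = 2 * pi / real N"
  have \<omega>: "\<omega> > 0" "\<omega> \<le> 2 * pi"
    using N by (auto simp: \<omega>_def divide_le_eq mult_le_cancel_left1)
  have c_def': "c u = complex_of_real (R u) * cis (\<omega> * u)" for u
    by (simp add: c_def \<omega>_def)
  have \<omega>P: "cis (\<omega> * (u + P)) = cis (\<omega> * u)" for u
  proof -
    have "cis (\<omega> * P) = 1"
    proof -
      have "\<omega> * P = 2 * pi * real p" using N by (simp add: \<omega>_def P_def)
      then show ?thesis by (metis Ints_of_nat cis_multiple_2pi)
    qed
    then show ?thesis by (simp add: distrib_left flip: cis_mult)
  qed
  have norm_c: "norm (c u) = R u" for u
    using R(2)[of u] by (simp add: c_def norm_mult)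
  \<comment> \<open>Equal projections have angles differing by full turns, hence parameters
    differing by a multiple of \<open>N\<close>, and \<open>asc\<close> applies. The bound
    \<open>v \<le> P - 1\<close> keeps the later passage in the rising part of the new
    height.\<close>
  have c_double: "\<zeta> u < \<zeta> v \<and> v \<le> P - 1" if uv: "u \<in> W" "v \<in> W" "u < v" "v - u < P" "c u = c v" for u v
  proof -
    have RR: "R u = R v" using uv(5) norm_c by metis
    have "R u \<noteq> 0" using R(2)[of u] by auto
    then have "cis (\<omega> * v) = cis (\<omega> * u)"
      using uv(5) RR by (simp add: c_def')
    then obtain n :: int where "\<omega> * v = \<omega> * u + 2 * pi * n"
      using sin_cos_eq_iff[of "\<omega> * v" "\<omega> * u"] by (metis cis.sel)
    then have n: "\<omega> * (v - u) = 2 * pi * n" by (simp add: right_diff_distrib)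
    have "v - u = (\<omega> * (v - u)) / \<omega>" using \<omega>(1) by simp
    also have "\<dots> = of_int n * real N" unfolding n by (simp add: \<omega>_def)
    finally have vu: "v - u = of_int n * real N" .
    then have "of_int n * real N > 0" using uv(3) by simp
    then have "n > 0" using N by (simp add: zero_less_mult_iff)
    then have "v - u = real (nat n) * real N" using vu by simp
    then show ?thesis
      using asc[of u v "nat n"] uv RR by (auto simp: W_def)
  qed
  have contc: "continuous_on S c" for S
    unfolding c_def
    by (intro continuous_intros continuous_on_subset[OF R(1)]) (use N in auto)
  have "L \<ge> 0" using \<zeta>[of 1 0] by simp
  then have "L-lipschitz_on UNIV \<zeta>"
    using \<zeta> by (auto simp: lipschitz_on_def dist_real_def)
  then have cont\<zeta>: "continuous_on S \<zeta>" for S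
    by (meson continuous_on_subset lipschitz_on_continuous_on subset_UNIV)
  \<comment> \<open>This rate brings the phase from 0 to \<open>pi\<close> between
    \<open>- 1/3\<close> and \<open>P - 2/3\<close>; the rate \<open>3 * pi\<close> brings it back
    to 0 in the remaining third of a unit. The minimum of the two lines joins them at
    \<open>P - 2/3\<close>.\<close>
  define \<alpha> where "\<alpha> = pi / (P - 1/3)"
  have \<alpha>: "\<alpha> > 0" "\<alpha> \<le> 3 * pi" "\<alpha> * (P - 1/3) = pi"
    using P1 by (auto simp: \<alpha>_def field_simps)
  define \<Phi> where "\<Phi> u = min (\<alpha> * (u + 1/3)) (3 * pi * (P - 1/3 - u))" for u
  have \<Phi>rise: "\<Phi> u = \<alpha> * (u + 1/3)" if "u \<le> P - 2/3" for u
  proof -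
    have "\<alpha> * (u + 1/3) \<le> \<alpha> * (P - 1/3)" using that \<alpha> by (intro mult_left_mono) auto
    moreover have "3 * pi * (1/3) \<le> 3 * pi * (P - 1/3 - u)" using that by (intro mult_left_mono) auto
    ultimately show ?thesis unfolding \<Phi>_def using \<alpha>(3) by (intro min_absorb1) linarith
  qed
  have \<Phi>fall: "\<Phi> u = 3 * pi * (P - 1/3 - u)" if "u \<ge> P - 2/3" for u
  proof -
    have "\<alpha> * (P - 1/3) \<le> \<alpha> * (u + 1/3)" using that \<alpha> by (intro mult_left_mono) auto
    moreover have "3 * pi * (P - 1/3 - u) \<le> 3 * pi * (1/3)" using that by (intro mult_left_mono) auto
    ultimately show ?thesis unfolding \<Phi>_def using \<alpha>(3) by (intro min_absorb2) linarith
  qed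
  define \<zeta>' where "\<zeta>' u = - cos (\<Phi> u)" for u
  have \<Phi>lip: "\<bar>\<Phi> u - \<Phi> v\<bar> \<le> 3 * pi * \<bar>u - v\<bar>" for u v
  proof -
    have "\<bar>\<alpha> * (u + 1/3) - \<alpha> * (v + 1/3)\<bar> = \<alpha> * \<bar>u - v\<bar>"
      using \<alpha>(1) by (simp add: abs_mult flip: right_diff_distrib)
    also have "\<dots> \<le> 3 * pi * \<bar>u - v\<bar>" using \<alpha> by (intro mult_right_mono) auto
    finally have 1: "\<bar>\<alpha> * (u + 1/3) - \<alpha> * (v + 1/3)\<bar> \<le> 3 * pi * \<bar>u - v\<bar>" .
    have 2: "\<bar>3 * pi * (P - 1/3 - u) - 3 * pi * (P - 1/3 - v)\<bar> \<le> 3 * pi * \<bar>u - v\<bar>"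
      by (simp add: abs_mult abs_minus_commute flip: right_diff_distrib)
    have "\<bar>min a b - min a' b'\<bar> \<le> e" if "\<bar>a - a'\<bar> \<le> e" "\<bar>b - b'\<bar> \<le> e" for a b a' b' e :: real
      using that by (auto simp: min_def)
    from this[OF 1 2] show ?thesis by (simp only: \<Phi>_def)
  qed
  have \<zeta>'lip: "\<bar>\<zeta>' u - \<zeta>' v\<bar> \<le> 3 * pi * \<bar>u - v\<bar>" for u v
    using abs_diff_cos_le[of "\<Phi> v" "\<Phi> u"] \<Phi>lip[of u v] by (simp add: \<zeta>'_def abs_minus_commute)
  have "(3 * pi)-lipschitz_on UNIV \<zeta>'"
    using \<zeta>'lip by (auto simp: lipschitz_on_def dist_real_def)
  then have cont\<zeta>': "continuous_on S \<zeta>'" for S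
    by (meson continuous_on_subset lipschitz_on_continuous_on subset_UNIV)
  have \<zeta>'mono: "\<zeta>' u < \<zeta>' v" if "u \<in> W" "u < v" "v \<le> P - 2/3" for u v
  proof -
    have "\<alpha> * (v + 1/3) \<le> \<alpha> * (P - 1/3)" "\<alpha> * (u + 1/3) < \<alpha> * (v + 1/3)" "0 \<le> \<alpha> * (u + 1/3)"
      using that \<alpha>(1) by (auto simp: W_def intro!: mult_left_mono mult_strict_left_mono)
    then show ?thesis
      using that \<alpha>(3) by (simp add: \<zeta>'_def \<Phi>rise cos_monotone_0_pi)
  qed
  \<comment> \<open>Pairs at distance at least 1/3 along the closed curve, measured both directly
    and across the seam. Closer pairs differ in angle by at most \<open>2 * pi / 3\<close>, because
    \<open>N\<close> is at least 1; this is the range of the chord estimate.\<close>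
  define D where "D = (W \<times> W) \<inter> ({w. 1/3 \<le> \<bar>fst w - snd w\<bar>} \<inter> {w. \<bar>fst w - snd w\<bar> \<le> P - 1/3})"
  have "compact D"
    unfolding D_def W_def
    by (intro compact_Int_closed compact_Times compact_Icc closed_Int closed_Collect_le continuous_intros)
  define C where "C = 2 / \<omega> * (L + 3 * pi)"
  \<comment> \<open>Across the seam the distance along the curve is \<open>u + P - v\<close>. Both
    points lie on the resting arc and both phases are near 0, so the sum of the phases bounds their
    difference.\<close>
  have wrap: "\<exists>x\<ge>0. \<omega> / 2 * x \<le> norm (c u - c v) \<and> \<bar>\<zeta> u - \<zeta> v\<bar> \<le> L * x \<and> \<bar>\<zeta>' u - \<zeta>' v\<bar> \<le> 3 * pi * x"
    if uv: "u \<in> W" "v \<in> W" "v - u > P - 1/3" for u v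
  proof (intro exI[of _ "u + P - v"] conjI)
    have u: "- (1/3) \<le> u" "u \<le> 0" and v: "P - 2/3 \<le> v" "v \<le> P - 1/3"
      using uv by (auto simp: W_def)
    show x0: "0 \<le> u + P - v" using u v by simp
    have Ru: "R u = 1" "\<zeta> u = 0" and Rv: "R v = 1" "\<zeta> v = 0"
      using rest[of u] rest[of v] u v by auto
    have "\<bar>\<omega> * (u + P) - \<omega> * v\<bar> = \<omega> * (u + P - v)"
      using \<omega>(1) x0 by (simp add: abs_mult flip: right_diff_distrib)
    moreover have "\<omega> * (u + P - v) \<le> 2 * pi * (1/3)"
      using \<omega> uv(3) x0 by (intro mult_mono) auto
    ultimately show "\<omega> / 2 * (u + P - v) \<le> norm (c u - c v)"
      using norm_diff_polar_ge[of 1 1 "\<omega> * (u + P)" "\<omega> * v"] by (simp add: c_def' Ru Rv \<omega>P)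
    show "\<bar>\<zeta> u - \<zeta> v\<bar> \<le> L * (u + P - v)"
      using Ru Rv x0 \<open>L \<ge> 0\<close> by simp
    have "\<alpha> * (u + 1/3) \<le> 3 * pi * (u + 1/3)" "0 \<le> \<alpha> * (u + 1/3)" "0 \<le> 3 * pi * (P - 1/3 - v)"
      using u v \<alpha> by (auto intro!: mult_right_mono)
    then have "\<bar>\<Phi> u - \<Phi> v\<bar> \<le> 3 * pi * (u + 1/3) + 3 * pi * (P - 1/3 - v)"
      using u v P1 by (simp only: \<Phi>rise \<Phi>fall)
    also have "\<dots> = 3 * pi * (u + P - v)" by (simp add: algebra_simps)
    finally show "\<bar>\<zeta>' u - \<zeta>' v\<bar> \<le> 3 * pi * (u + P - v)"
      using abs_diff_cos_le[of "\<Phi> v" "\<Phi> u"] by (simp add: \<zeta>'_def abs_minus_commute)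
  qed
  have near: "\<bar>\<zeta> u - \<zeta> v\<bar> \<le> C * norm (c u - c v) \<and> \<bar>\<zeta>' u - \<zeta>' v\<bar> \<le> C * norm (c u - c v)"
    if uv: "u \<in> W" "v \<in> W" "(u, v) \<notin> D" for u v
  proof -
    have "\<exists>x\<ge>0. \<omega> / 2 * x \<le> norm (c u - c v) \<and> \<bar>\<zeta> u - \<zeta> v\<bar> \<le> L * x \<and> \<bar>\<zeta>' u - \<zeta>' v\<bar> \<le> 3 * pi * x"
    proof -
      consider "\<bar>u - v\<bar> < 1/3" | "v - u > P - 1/3" | "u - v > P - 1/3"
        using uv by (auto simp: D_def) linarith
      then show ?thesis
      proof cases
        case 1
        have eq: "\<bar>\<omega> * u - \<omega> * v\<bar> = \<omega> * \<bar>u - v\<bar>"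
          using \<omega>(1) by (simp add: abs_mult flip: right_diff_distrib)
        also have "\<omega> * \<bar>u - v\<bar> \<le> 2 * pi * (1/3)"
          using \<omega> 1 by (intro mult_mono) auto
        finally have "\<omega> / 2 * \<bar>u - v\<bar> \<le> norm (c u - c v)"
          using norm_diff_polar_ge[of "R u" "R v" "\<omega> * u" "\<omega> * v"] R(2) eq by (simp add: c_def')
        then show ?thesis
          using \<zeta> \<zeta>'lip by (intro exI[of _ "\<bar>u - v\<bar>"]) auto
      next
        case 2
        then show ?thesis using wrap[of u v] uv by blast
      next
        case 3
        then show ?thesis using wrap[of v u] uv by (simp add: norm_minus_commute abs_minus_commute)
      qed
    qed
    then obtain x where x: "x \<ge> 0" "\<omega> / 2 * x \<le> norm (c u - c v)"
      "\<bar>\<zeta> u - \<zeta> v\<bar> \<le> L * x" "\<bar>\<zeta>' u - \<zeta>' v\<bar> \<le> 3 * pi * x" by blast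
    have "C * (\<omega> / 2 * x) \<le> C * norm (c u - c v)"
      using x(2) \<omega>(1) \<open>L \<ge> 0\<close> by (intro mult_left_mono) (auto simp: C_def)
    moreover have "C * (\<omega> / 2 * x) = L * x + 3 * pi * x"
      using \<omega>(1) by (simp add: C_def field_simps)
    moreover have "L * x \<ge> 0" "3 * pi * x \<ge> 0" using x(1) \<open>L \<ge> 0\<close> by auto
    ultimately show ?thesis using x(3,4) by linarith
  qed
  have far: "\<zeta> u < \<zeta> v \<and> \<zeta>' u < \<zeta>' v \<or> \<zeta> v < \<zeta> u \<and> \<zeta>' v < \<zeta>' u" if uv: "(u, v) \<in> D" "c u = c v" for u v
  proof -
    have W: "u \<in> W" "v \<in> W" "\<bar>u - v\<bar> < P" "u \<noteq> v" using uv(1) by (auto simp: D_def)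
    show ?thesis
    proof (cases "u < v")
      case True
      then show ?thesis using c_double[of u v] \<zeta>'mono[of u v] W uv(2) by auto
    next
      case False
      then show ?thesis using c_double[of v u] \<zeta>'mono[of v u] W uv(2) by auto
    qed
  qed
  have "ambient_isotopic ((\<lambda>u. (c u, \<zeta> u)) ` W) ((\<lambda>u. (c u, \<zeta>' u)) ` W)"
  proof (rule ambient_isotopic_vertical[OF _ _ contc cont\<zeta> cont\<zeta>' \<open>compact D\<close> _ near far])
    show "compact W" "W \<noteq> {}" "D \<subseteq> W \<times> W"
      using P1 by (auto simp: W_def D_def)
  qed
  moreover have "trivial_knot ((\<lambda>u. (c u, \<zeta>' u)) ` W)"
  proof -
    \<comment> \<open>\<open>U\<close> and \<open>V\<close> invert the rising and the falling branch
      of \<open>\<Phi>\<close>: the two points of the knot at height \<open>- cos \<phi>\<close>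
      have these parameters.\<close>
    define U where "U \<phi> = - (1/3) + \<phi> / \<alpha>" for \<phi>
    define V where "V \<phi> = P - 1/3 - \<phi> / (3 * pi)" for \<phi>
    have U: "U \<phi> \<in> {- (1/3)..P - 2/3}" "\<Phi> (U \<phi>) = \<phi>" if "\<phi> \<in> {0..pi}" for \<phi>
    proof -
      have "\<phi> / \<alpha> \<le> pi / \<alpha>" using that \<alpha>(1) by (intro divide_right_mono) auto
      moreover have "pi / \<alpha> = P - 1/3" using \<alpha> by (simp add: field_simps)
      ultimately show "U \<phi> \<in> {- (1/3)..P - 2/3}"
        using that \<alpha>(1) by (auto simp: U_def)
      then show "\<Phi> (U \<phi>) = \<phi>"
        using \<alpha>(1) by (simp add: \<Phi>rise) (simp add: U_def)
    qed
    have V: "V \<phi> \<in> {P - 2/3..P - 1/3}" "\<Phi> (V \<phi>) = \<phi>" if "\<phi> \<in> {0..pi}" for \<phi>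
    proof -
      have "\<phi> / (3 * pi) \<le> 1/3" using that by (simp add: divide_le_eq)
      moreover have "0 \<le> \<phi> / (3 * pi)" using that by simp
      ultimately show "V \<phi> \<in> {P - 2/3..P - 1/3}"
        unfolding V_def atLeastAtMost_iff by (intro conjI; linarith)
      then show "\<Phi> (V \<phi>) = \<phi>" by (simp add: \<Phi>fall) (simp add: V_def)
    qed
    have image: "(\<lambda>u. (c u, \<zeta>' u)) ` W =
        (\<lambda>\<phi>. (c (U \<phi>), - cos \<phi>)) ` {0..pi} \<union> (\<lambda>\<phi>. (c (V \<phi>), - cos \<phi>)) ` {0..pi}"
    proof (intro equalityI subsetI)
      fix w assume "w \<in> (\<lambda>u. (c u, \<zeta>' u)) ` W"
      then obtain u where u: "u \<in> W" "w = (c u, - cos (\<Phi> u))" by (auto simp: \<zeta>'_def)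
      show "w \<in> (\<lambda>\<phi>. (c (U \<phi>), - cos \<phi>)) ` {0..pi} \<union> (\<lambda>\<phi>. (c (V \<phi>), - cos \<phi>)) ` {0..pi}"
      proof (cases "u \<le> P - 2/3")
        case True
        have "\<alpha> * (u + 1/3) \<le> \<alpha> * (P - 1/3)" "0 \<le> \<alpha> * (u + 1/3)"
          using True u(1) \<alpha>(1) by (auto simp: W_def intro!: mult_left_mono)
        then have "\<Phi> u \<in> {0..pi}" "U (\<Phi> u) = u"
          using \<Phi>rise[OF True] \<alpha> by (auto simp: U_def)
        then show ?thesis using u(2) by (auto simp: image_iff intro!: bexI[of _ "\<Phi> u"])
      next
        case False
        have "3 * pi * (P - 1/3 - u) \<le> 3 * pi * (1/3)" "0 \<le> 3 * pi * (P - 1/3 - u)"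
          using False u(1) by (auto simp: W_def intro!: mult_left_mono)
        then have "\<Phi> u \<in> {0..pi}" "V (\<Phi> u) = u"
          using \<Phi>fall[of u] False by (auto simp: V_def)
        then show ?thesis using u(2) by (auto simp: image_iff intro!: bexI[of _ "\<Phi> u"])
      qed
    next
      fix w assume "w \<in> (\<lambda>\<phi>. (c (U \<phi>), - cos \<phi>)) ` {0..pi} \<union> (\<lambda>\<phi>. (c (V \<phi>), - cos \<phi>)) ` {0..pi}"
      then obtain \<phi> where \<phi>: "\<phi> \<in> {0..pi}" "w = (c (U \<phi>), - cos \<phi>) \<or> w = (c (V \<phi>), - cos \<phi>)"
        by auto
      have "U \<phi> \<in> W" "V \<phi> \<in> W" using U(1)[OF \<phi>(1)] V(1)[OF \<phi>(1)] P1 by (auto simp: W_def)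
      with \<phi> show "w \<in> (\<lambda>u. (c u, \<zeta>' u)) ` W"
        using U(2)[OF \<phi>(1)] V(2)[OF \<phi>(1)] by (auto simp: \<zeta>'_def image_iff intro: bexI[of _ "U \<phi>"] bexI[of _ "V \<phi>"])
    qed
    define d where "d \<phi> = c (U \<phi>) - c (V \<phi>)" for \<phi>
    have contU: "continuous_on {0..pi} (\<lambda>\<phi>. c (U \<phi>))" and contV: "continuous_on {0..pi} (\<lambda>\<phi>. c (V \<phi>))"
      using \<alpha>(1) unfolding U_def V_def
      by (intro continuous_on_compose2[OF contc[of UNIV]] continuous_intros; force)+
    \<comment> \<open>The form of \<open>d\<close> while \<open>U\<close> is on the resting arc,
      where \<open>R\<close> is 1. As the phase grows, \<open>U\<close> moves forward and
      \<open>V\<close> backward; at the ends the two points coincide, so their velocities add up in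
      the difference and the zeros are simple.\<close>
    define d' where "d' \<phi> = cis (\<omega> * U \<phi>) - cis (\<omega> * V \<phi>)" for \<phi>
    have dd: "d \<phi> = d' \<phi>" if "\<phi> \<in> {0..pi}" "U \<phi> \<in> {-1..0} \<union> {P - 1..P}" for \<phi>
      using rest[OF that(2)] rest[of "V \<phi>"] V(1)[OF that(1)] by (simp add: d_def d'_def c_def')
    have deriv: "(d' has_vector_derivative (\<omega> / \<alpha>) *\<^sub>R (\<i> * cis (\<omega> * U \<phi>)) + (\<omega> / (3 * pi)) *\<^sub>R (\<i> * cis (\<omega> * V \<phi>)))
        (at \<phi> within {0..pi})" for \<phi>
      unfolding d'_def U_def V_def has_vector_derivative_def
      using \<alpha>(1) by (auto intro!: derivative_eq_intros simp: fun_eq_iff algebra_simps)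
    have U_ends: "U 0 = - (1/3)" "U pi = P - 2/3" "V 0 = - (1/3) + P" "V pi = P - 2/3"
      using \<alpha> by (auto simp: U_def V_def field_simps)
    have speed: "(\<omega> / \<alpha>) *\<^sub>R (\<i> * cis t) + (\<omega> / (3 * pi)) *\<^sub>R (\<i> * cis t) \<noteq> 0" for t
    proof -
      have "\<omega> / \<alpha> + \<omega> / (3 * pi) > 0" using \<omega>(1) \<alpha>(1) by (intro add_pos_pos divide_pos_pos) auto
      then have "(\<omega> / \<alpha> + \<omega> / (3 * pi)) *\<^sub>R (\<i> * cis t) \<noteq> 0" by simp
      then show ?thesis unfolding scaleR_add_left .
    qed
    obtain e where e: "continuous_on {0..pi} e" "\<And>\<phi>. \<phi> \<in> {0..pi} \<Longrightarrow> e \<phi> \<noteq> 0"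
      "\<And>\<phi>. \<phi> \<in> {0..pi} \<Longrightarrow> d \<phi> = of_real (sin \<phi>) * e \<phi>"
    proof (rule factor_sin[of d])
      show "continuous_on {0..pi} d"
        unfolding d_def by (intro continuous_intros contU contV)
      show "d \<phi> \<noteq> 0" if \<phi>: "0 < \<phi>" "\<phi> < pi" for \<phi>
      proof
        assume "d \<phi> = 0"
        then have eq: "c (U \<phi>) = c (V \<phi>)" by (simp add: d_def)
        have "\<phi> / (3 * pi) < 1/3" using \<phi> by (simp add: divide_less_eq)
        then have "V \<phi> > P - 2/3" unfolding V_def by linarith
        moreover have "0 < \<phi> / \<alpha>" "0 < \<phi> / (3 * pi)" using \<phi> \<alpha>(1) by auto
        then have "U \<phi> > - (1/3)" "V \<phi> < P - 1/3" unfolding U_def V_def by linarith+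
        moreover have "U \<phi> \<le> P - 2/3" using U(1)[of \<phi>] \<phi> by auto
        ultimately show False
          using c_double[of "U \<phi>" "V \<phi>"] eq by (auto simp: W_def)
      qed
      have U0: "U 0 \<in> {-1..0} \<union> {P - 1..P}" and Upi: "U pi \<in> {-1..0} \<union> {P - 1..P}"
        by (auto simp: U_ends)
      have "d' 0 = 0" "d' pi = 0" unfolding d'_def U_ends \<omega>P by simp_all
      then show "d 0 = 0" "d pi = 0"
        using dd[OF _ U0] dd[OF _ Upi] by auto
      have "(d has_vector_derivative (\<omega> / \<alpha>) *\<^sub>R (\<i> * cis (\<omega> * U 0)) + (\<omega> / (3 * pi)) *\<^sub>R (\<i> * cis (\<omega> * V 0)))
        (at 0 within {0..pi})"
      proof (rule has_vector_derivative_transform_within[OF deriv])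
        \<comment> \<open>For phases this close to 0, \<open>U\<close> is within 1/3 of its end
          value and has not left the resting arc. The same radius serves at
          \<open>pi\<close>.\<close>
        show "0 < \<alpha> / 3" using \<alpha>(1) by simp
        show "d' \<phi> = d \<phi>" if "\<phi> \<in> {0..pi}" "dist \<phi> 0 < \<alpha> / 3" for \<phi>
        proof -
          have "\<phi> / \<alpha> < 1/3" using that \<alpha>(1) by (simp add: dist_real_def field_simps)
          then show ?thesis using dd[OF that(1)] U(1)[OF that(1)] by (auto simp: U_def)
        qed
      qed simp
      then show "(d has_vector_derivative (\<omega> / \<alpha>) *\<^sub>R (\<i> * cis (\<omega> * - (1/3))) + (\<omega> / (3 * pi)) *\<^sub>R (\<i> * cis (\<omega> * - (1/3))))
        (at 0 within {0..pi})"
        by (simp only: U_ends \<omega>P)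
      have "(d has_vector_derivative (\<omega> / \<alpha>) *\<^sub>R (\<i> * cis (\<omega> * U pi)) + (\<omega> / (3 * pi)) *\<^sub>R (\<i> * cis (\<omega> * V pi)))
        (at pi within {0..pi})"
      proof (rule has_vector_derivative_transform_within[OF deriv])
        show "0 < \<alpha> / 3" using \<alpha>(1) by simp
        show "d' \<phi> = d \<phi>" if "\<phi> \<in> {0..pi}" "dist \<phi> pi < \<alpha> / 3" for \<phi>
        proof -
          have "pi / \<alpha> - \<phi> / \<alpha> = (pi - \<phi>) / \<alpha>" by (simp add: diff_divide_distrib)
          also have "\<dots> < 1/3" using that \<alpha>(1) by (simp add: dist_real_def field_simps)
          finally have "U \<phi> > P - 1" using U_ends(2) unfolding U_def by linarith
          then show ?thesis using dd[OF that(1)] U(1)[OF that(1)] by auto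
        qed
      qed simp
      then show "(d has_vector_derivative (\<omega> / \<alpha>) *\<^sub>R (\<i> * cis (\<omega> * (P - 2/3))) + (\<omega> / (3 * pi)) *\<^sub>R (\<i> * cis (\<omega> * (P - 2/3))))
        (at pi within {0..pi})"
        by (simp only: U_ends)
    qed (rule speed | blast)+
    show ?thesis
      unfolding image
      by (rule trivial_knot_two_arcs[OF contV contU e(1,2)]) (use e(3) in \<open>auto simp: d_def\<close>)
  qed
  ultimately show ?thesis
    unfolding trivial_knot_def W_def by (rule ambient_isotopic_trans)
qed

section \<open>Ascending closed braids\<close>


text \<open>Consecutive unit intervals share an endpoint, so the estimates add up by induction on
  the number of integers passed.\<close>

lemma lipschitz_across_integers:
  fixes f :: "real \<Rightarrow> 'a::real_normed_vector"
  assumes "\<And>(K::int) u v. u \<in> {of_int K..of_int K + 1} \<Longrightarrow> v \<in> {of_int K..of_int K + 1} \<Longrightarrow>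
    norm (f u - f v) \<le> L * \<bar>u - v\<bar>"
  shows "norm (f u - f v) \<le> L * \<bar>u - v\<bar>"
proof -
  have le: "norm (f u - f v) \<le> L * (v - u)" if "u \<le> v" for u v
    using that
  proof (induction "nat (\<lfloor>v\<rfloor> - \<lfloor>u\<rfloor>)" arbitrary: u)
    case 0
    then have "\<lfloor>v\<rfloor> = \<lfloor>u\<rfloor>" using floor_mono[OF 0(2)] by simp
    then have "u \<in> {of_int \<lfloor>u\<rfloor>..of_int \<lfloor>u\<rfloor> + 1}" "v \<in> {of_int \<lfloor>u\<rfloor>..of_int \<lfloor>u\<rfloor> + 1}"
      by (auto; linarith)+
    from assms[OF this] show ?case using 0(2) by simp
  next
    case (Suc k)
    define w :: real where "w = of_int (\<lfloor>u\<rfloor> + 1)"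
    have "\<lfloor>u\<rfloor> + 1 \<le> \<lfloor>v\<rfloor>" using Suc(2) by linarith
    then have wv: "w \<le> v" unfolding w_def by (simp add: le_floor_iff)
    have "k = nat (\<lfloor>v\<rfloor> - \<lfloor>w\<rfloor>)" using Suc(2) unfolding w_def floor_of_int by linarith
    from Suc(1)[OF this wv] have 1: "norm (f w - f v) \<le> L * (v - w)" .
    have u: "u \<in> {of_int \<lfloor>u\<rfloor>..of_int \<lfloor>u\<rfloor> + 1}" "w \<in> {of_int \<lfloor>u\<rfloor>..of_int \<lfloor>u\<rfloor> + 1}" "u \<le> w"
      unfolding w_def by (auto; linarith)+
    have "norm (f u - f w) \<le> L * (w - u)"
      using assms[OF u(1,2)] u(3) by simp
    with 1 show ?case
      using norm_triangle_ineq[of "f u - f w" "f w - f v"] by (simp add: algebra_simps)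
  qed
  show ?thesis
    using le[of u v] le[of v u] by (cases "u \<le> v") (auto simp: norm_minus_commute)
qed

text \<open>
  The position, at time \<open>u\<close>, of a point that sits at \<open>X K\<close> at each integer time \<open>K\<close> and makes a half
  turn from \<open>X K\<close> to \<open>X (K + 1)\<close> in between, counterclockwise if \<open>\<sigma> K = 1\<close> and clockwise if \<open>\<sigma> K = -1\<close>.
\<close>

definition strand :: "(int \<Rightarrow> nat) \<Rightarrow> (int \<Rightarrow> real) \<Rightarrow> real \<Rightarrow> complex" where
  "strand X \<sigma> u = of_nat (X \<lfloor>u\<rfloor>) +
     (of_nat (X (\<lfloor>u\<rfloor> + 1)) - of_nat (X \<lfloor>u\<rfloor>)) * (1 - cis (\<sigma> \<lfloor>u\<rfloor> * (pi * frac u))) / 2"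

text \<open>The point of this form is the closed interval: at its right end the floor already
  belongs to the next interval, and agreement of the two formulas there gives continuity.\<close>

lemma strand_on_unit_interval:
  assumes \<sigma>: "\<sigma> K = 1 \<or> \<sigma> K = -1" and u: "u \<in> {of_int K..of_int K + 1}"
  shows "strand X \<sigma> u = of_nat (X K) +
    (of_nat (X (K + 1)) - of_nat (X K)) * (1 - cis (\<sigma> K * (pi * (u - of_int K)))) / 2"
proof (cases "u = of_int K + 1")
  case True
  then have "u = of_int (K + 1)" by simp
  then have "strand X \<sigma> u = of_nat (X (K + 1))"
    unfolding strand_def by (simp only: floor_of_int frac_of_int) simp
  moreover have "cis (\<sigma> K * (pi * (u - of_int K))) = -1"
    using \<sigma> True by (auto simp: complex_eq_iff)
  ultimately show ?thesis by (simp add: field_simps)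
next
  case False
  then have "\<lfloor>u\<rfloor> = K" using u by (auto simp: floor_eq_iff)
  then show ?thesis by (simp add: strand_def frac_def)
qed

text \<open>A half turn runs on a circle of radius at most 1/2 with angular speed
  \<open>pi\<close>.\<close>

lemma strand_lipschitz:
  assumes \<sigma>: "\<And>K. \<sigma> K = 1 \<or> \<sigma> K = -1"
    and X: "\<And>K. \<bar>real (X (K + 1)) - real (X K)\<bar> \<le> 1"
  shows "norm (strand X \<sigma> u - strand X \<sigma> v) \<le> pi / 2 * \<bar>u - v\<bar>"
proof (rule lipschitz_across_integers)
  fix K :: int and u v :: real
  assume u: "u \<in> {of_int K..of_int K + 1}" and v: "v \<in> {of_int K..of_int K + 1}"
  define D where "D = real (X (K + 1)) - real (X K)"
  define a b where "a = \<sigma> K * (pi * (u - of_int K))" and "b = \<sigma> K * (pi * (v - of_int K))"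
  have "strand X \<sigma> u - strand X \<sigma> v = of_real (D / 2) * (cis b - cis a)"
    unfolding strand_on_unit_interval[OF \<sigma> u] strand_on_unit_interval[OF \<sigma> v] a_def[symmetric] b_def[symmetric]
    by (simp add: D_def field_simps)
  then have "norm (strand X \<sigma> u - strand X \<sigma> v) = \<bar>D\<bar> / 2 * norm (cis b - cis a)"
    by (simp only: norm_mult norm_of_real abs_divide abs_numeral)
  also have "\<dots> \<le> 1 / 2 * \<bar>b - a\<bar>"
    using X[of K] by (intro mult_mono norm_diff_cis_le) (auto simp: D_def)
  also have "b - a = \<sigma> K * (pi * (v - u))"
    unfolding a_def b_def by (simp add: algebra_simps)
  also have "\<bar>\<dots>\<bar> = pi * \<bar>u - v\<bar>"
    using \<sigma>[of K] by (auto simp: abs_mult)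
  finally show "norm (strand X \<sigma> u - strand X \<sigma> v) \<le> pi / 2 * \<bar>u - v\<bar>" by simp
qed

text \<open>Tracks single points by their starting positions, whereas
  \<open>half_turn_config\<close> only gives the set they form.\<close>

definition half_turn_point :: "nat \<Rightarrow> real \<Rightarrow> nat \<Rightarrow> complex" where
  "half_turn_point i \<phi> x =
     (if x = i then of_nat i + (1 - cis \<phi>) / 2
      else if x = i + 1 then of_nat (i + 1) - (1 - cis \<phi>) / 2
      else of_nat x)"

lemma half_turn_config_image:
  assumes "1 \<le> i" "i < p"
  shows "half_turn_config p i \<phi> = half_turn_point i \<phi> ` {1..p}"
proof -
  have "{1..p} = ({1..p} - {i, i + 1}) \<union> {i, i + 1}" using assms by auto
  then have "half_turn_point i \<phi> ` {1..p} =
      half_turn_point i \<phi> ` ({1..p} - {i, i + 1}) \<union> {half_turn_point i \<phi> i, half_turn_point i \<phi> (i + 1)}"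
    by (metis image_Un image_insert image_empty)
  moreover have "half_turn_point i \<phi> ` ({1..p} - {i, i + 1}) = of_nat ` ({1..p} - {i, i + 1})"
    by (intro image_cong) (auto simp: half_turn_point_def)
  moreover have "half_turn_point i \<phi> i = of_nat i + 1/2 - cis \<phi> / 2"
    "half_turn_point i \<phi> (i + 1) = of_nat i + 1/2 + cis \<phi> / 2"
    by (simp_all add: half_turn_point_def field_simps)
  ultimately show ?thesis by (simp add: half_turn_config_def)
qed

text \<open>
  Travelling along the closed braid \<open>w\<close>, one is at position \<open>X K\<close> when the letter \<open>w ! (K mod N)\<close>
  starts (the resting arcs count as a letter, at \<open>K mod N = N - 1\<close>). By \<open>asc\<close>, at each crossing the
  passage that comes first is the lower one: in a \<open>Gen\<close>, the point that starts further left passes below.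
\<close>

lemma trivial_knot_ascending_braid:
  fixes p :: nat and w :: braid_word and X :: "int \<Rightarrow> nat" and I :: "nat \<Rightarrow> nat"
  defines "N \<equiv> length w + 1"
  assumes p: "p \<ge> 1"
    and periodic: "\<And>K. X (K + int (p * N)) = X K"
    and bij: "\<And>K. bij_betw (\<lambda>m. X (K + int (m * N))) {..<p} {1..p}"
    and base: "X 0 = 1"
    and rest: "\<And>K. K mod int N = int (length w) \<Longrightarrow> X (K + 1) = X K"
    and I: "\<And>k. k < length w \<Longrightarrow> 1 \<le> I k \<and> I k < p \<and> (w ! k = Gen (I k) \<or> w ! k = GenInv (I k))"
    and step: "\<And>K k. k < length w \<Longrightarrow> K mod int N = int k \<Longrightarrow>
      X (K + 1) = (if X K = I k then I k + 1 else if X K = I k + 1 then I k else X K)"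
    and asc: "\<And>K K' k. k < length w \<Longrightarrow> 0 \<le> K \<Longrightarrow> K < K' \<Longrightarrow> K' < int (p * N) \<Longrightarrow>
      K mod int N = int k \<Longrightarrow> K' mod int N = int k \<Longrightarrow>
      (X K = I k \<and> X K' = I k + 1 \<longrightarrow> w ! k = Gen (I k)) \<and>
      (X K = I k + 1 \<and> X K' = I k \<longrightarrow> w ! k = GenInv (I k))"
  shows "trivial_knot (braid_closure p w)"
proof -
  define n where "n = length w"
  have N: "N = n + 1" "N \<ge> 1" by (auto simp: N_def n_def)
  \<comment> \<open>At the resting slot the lookup in \<open>w\<close> is out of range and either
    sign may result; the strand is constant there for both signs, as
    \<open>X (K + 1) = X K\<close>.\<close>
  define \<sigma> where "\<sigma> K = (if w ! nat (K mod int N) = GenInv (I (nat (K mod int N))) then -1 else 1 :: real)" for K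
  have \<sigma>: "\<sigma> K = 1 \<or> \<sigma> K = -1" for K by (simp add: \<sigma>_def)
  define Z where "Z = strand X \<sigma>"
  define P where "P = real (p * N)"
  have P1: "P \<ge> 1" using mult_mono[of 1 "real p" 1 "real N"] N(2) p by (simp add: P_def)
  have slot: "K mod int N = int n \<or> (\<exists>k<n. K mod int N = int k)" for K
  proof -
    have "0 \<le> K mod int N" "K mod int N < int N" using N by auto
    then obtain k where "K mod int N = int k" "k < N" by (metis nonneg_int_cases of_nat_less_iff)
    then show ?thesis using N(1) by (cases "k = n") auto
  qed
  have Xrange: "X K \<in> {1..p}" for K
    using bij_betwE[OF bij[of K]] p by (auto dest!: bspec[of _ _ 0])
  have XD: "\<bar>real (X (K + 1)) - real (X K)\<bar> \<le> 1" for K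
    using slot[of K] rest[of K] step[of _ K] by (auto simp: n_def)
  have Xinj: "m = m'" if "X (K + int (m * N)) = X (K + int (m' * N))" "m < p" "m' < p" for K m m'
    using inj_onD[OF bij_betw_imp_inj_on[OF bij[of K]] that(1)] that(2,3) by simp
  have shift: "\<lfloor>u + of_int z\<rfloor> = \<lfloor>u\<rfloor> + z" "frac (u + of_int z) = frac u" for u :: real and z
    by (simp_all add: frac_def)
  have Zform: "Z u = of_nat (X \<lfloor>u\<rfloor>) +
     (of_nat (X (\<lfloor>u\<rfloor> + 1)) - of_nat (X \<lfloor>u\<rfloor>)) * (1 - cis (\<sigma> \<lfloor>u\<rfloor> * (pi * frac u))) / 2" for u
    by (simp add: Z_def strand_def)
  have ReZ: "Re (Z u) = real (X \<lfloor>u\<rfloor>) +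
     (real (X (\<lfloor>u\<rfloor> + 1)) - real (X \<lfloor>u\<rfloor>)) * (1 - cos (pi * frac u)) / 2" for u
    using \<sigma>[of "\<lfloor>u\<rfloor>"] by (auto simp: Zform)
  have ImZ: "Im (Z u) = - \<sigma> \<lfloor>u\<rfloor> * (real (X (\<lfloor>u\<rfloor> + 1)) - real (X \<lfloor>u\<rfloor>)) * sin (pi * frac u) / 2" for u
    using \<sigma>[of "\<lfloor>u\<rfloor>"] by (auto simp: Zform)
  have Zrest: "Z u = of_nat (X \<lfloor>u\<rfloor>)" if "\<lfloor>u\<rfloor> mod int N = int n" for u
    using rest[of "\<lfloor>u\<rfloor>"] that by (simp add: Zform n_def)
  have Zint: "Z u = of_nat (X \<lfloor>u\<rfloor>)" if "frac u = 0" for u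
    unfolding Zform that by simp
  have Zper: "Z (u + P) = Z u" for u
  proof -
    have "\<lfloor>u + P\<rfloor> = \<lfloor>u\<rfloor> + int (p * N)" "frac (u + P) = frac u"
      using shift[of u "int (p * N)"] unfolding P_def of_int_of_nat_eq by auto
    moreover have "X (\<lfloor>u\<rfloor> + int (p * N) + 1) = X (\<lfloor>u\<rfloor> + 1)"
      using periodic[of "\<lfloor>u\<rfloor> + 1"] by (simp add: algebra_simps)
    moreover have "\<sigma> (\<lfloor>u\<rfloor> + int (p * N)) = \<sigma> \<lfloor>u\<rfloor>" by (simp add: \<sigma>_def)
    ultimately show ?thesis unfolding Zform by (simp only: periodic)
  qed
  have Rge: "Re (Z u) \<ge> 1" for u
  proof -
    define t where "t = (1 - cos (pi * frac u)) / 2"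
    have t: "0 \<le> t" "t \<le> 1"
      using cos_le_one[of "pi * frac u"] cos_ge_minus_one[of "pi * frac u"] by (auto simp: t_def)
    have "(1 - t) * 1 + t * 1 \<le> (1 - t) * real (X \<lfloor>u\<rfloor>) + t * real (X (\<lfloor>u\<rfloor> + 1))"
      using t Xrange[of "\<lfloor>u\<rfloor>"] Xrange[of "\<lfloor>u\<rfloor> + 1"] by (intro add_mono mult_left_mono) auto
    also have "\<dots> = Re (Z u)" by (simp add: ReZ t_def field_simps)
    finally show ?thesis by simp
  qed
  have lip: "norm (Z u - Z v) \<le> pi / 2 * \<bar>u - v\<bar>" for u v
    unfolding Z_def by (intro strand_lipschitz \<sigma> XD)
  then have "(pi / 2)-lipschitz_on UNIV Z"
    by (auto simp: lipschitz_on_def dist_norm)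
  then have contZ: "continuous_on UNIV Z"
    by (rule lipschitz_on_continuous_on)
  have rest0: "Z u = 1" if u: "u \<in> {-1..0}" for u
  proof (cases "u = 0")
    case True
    then show ?thesis using base by (simp add: Zint)
  next
    case False
    then have "\<lfloor>u\<rfloor> = -1" using u by (simp add: floor_eq_iff)
    moreover have "-1 mod int N = int n" using N by (simp add: zmod_minus1)
    moreover have "X (-1) = 1" using rest[of "-1"] calculation(2) base by (simp add: n_def)
    ultimately show ?thesis by (simp add: Zrest)
  qed
  have restP: "Z u = 1" if "u \<in> {-1..0} \<union> {P - 1..P}" for u
    using that rest0[of u] rest0[of "u - P"] Zper[of "u - P"] by auto
  \<comment> \<open>The parameters differ by whole turns, so the same letter is performed in two
    different passages. Equal radii then leave only the two exchanged strings, halfway through their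
    half turn.\<close>
  have crossing: "Im (Z u) < Im (Z v) \<and> v \<le> P - 1"
    if uv: "- (1/3) \<le> u" "u < v" "v \<le> P - 1/3" "v - u < P" "v - u = real l * real N" "Re (Z u) = Re (Z v)"
    for u v l
  proof -
    define K where "K = \<lfloor>u\<rfloor>"
    have v: "v = u + of_int (int (l * N))" using uv(5) by simp
    have K': "\<lfloor>v\<rfloor> = K + int (l * N)" "frac v = frac u"
      unfolding K_def v by (rule shift)+
    have "real l * real N > 0" using uv(2,5) by simp
    then have l0: "l > 0" by (simp add: zero_less_mult_iff)
    have "real l * real N < real p * real N" using uv(4,5) by (simp add: P_def)
    then have lp: "l < p" by (simp add: mult_less_cancel_right)
    have Xne: "X K \<noteq> X (K + int (l * N))"
      using Xinj[of K 0 l] l0 lp p by auto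
    have modK: "(K + int (l * N)) mod int N = K mod int N" by simp
    have "K mod int N \<noteq> int n"
    proof
      assume "K mod int N = int n"
      then have "Z u = of_nat (X K)" "Z v = of_nat (X (K + int (l * N)))"
        using Zrest[of u] Zrest[of v] modK K' by (auto simp: K_def)
      then show False using uv(6) Xne by simp
    qed
    then obtain k where k: "k < n" "K mod int N = int k" using slot[of K] by blast
    have "K \<ge> -1" using uv(1) unfolding K_def by (simp add: le_floor_iff)
    moreover have "K \<noteq> -1" using k N by (auto simp: zmod_minus1)
    ultimately have K0: "K \<ge> 0" by simp
    have "v < of_int (int (p * N))" using uv(3) by (simp add: P_def)
    then have K'P: "K + int (l * N) < int (p * N)"
      unfolding K'(1)[symmetric] by (simp only: floor_less_iff)
    \<comment> \<open>The last slot before \<open>P\<close> is a resting arc, while the slot at hand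
      carries a letter; hence the later passage is over by \<open>P - 1\<close>.\<close>
    have "K + int (l * N) \<noteq> int (p * N) - 1"
    proof
      assume eq: "K + int (l * N) = int (p * N) - 1"
      have "(int (p * N) - 1) mod int N = (-1) mod int N"
        by (metis mod_mult_self3 of_nat_mult uminus_add_conv_diff add.commute)
      then have "K mod int N = int n"
        using modK eq N by (simp add: zmod_minus1)
      then show False using k by simp
    qed
    then have "\<lfloor>v\<rfloor> + 1 \<le> int (p * N) - 1" using K'P K'(1) by linarith
    then have vP: "v \<le> P - 1" unfolding P_def by linarith
    define i where "i = I k"
    define E where "E = (1 - cos (pi * frac u)) / 2"
    define x y where "x = X K" and "y = X (K + int (l * N))"
    have stepK: "X (K + 1) = (if x = i then i + 1 else if x = i + 1 then i else x)"
      using step[of k K] k by (simp add: i_def x_def n_def)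
    have stepK': "X (K + int (l * N) + 1) = (if y = i then i + 1 else if y = i + 1 then i else y)"
      using step[of k "K + int (l * N)"] k modK by (simp add: i_def y_def n_def)
    have E: "0 \<le> E" "E < 1"
    proof -
      have "pi * frac u < pi * 1" using frac_lt_1[of u] by (intro mult_strict_left_mono) auto
      then have "cos (pi * frac u) > -1"
        using cos_monotone_0_pi[of "pi * frac u" pi] by simp
      then show "0 \<le> E" "E < 1" by (auto simp: E_def)
    qed
    have Ru: "Re (Z u) = real x + (real (X (K + 1)) - real x) * E"
      by (simp add: ReZ x_def E_def K_def)
    have Rv: "Re (Z v) = real y + (real (X (K + int (l * N) + 1)) - real y) * E"
      by (simp add: ReZ y_def E_def K')
    have xy: "x \<noteq> y" using Xne by (simp add: x_def y_def)
    \<comment> \<open>The radius during the letter, as a function of the starting position. It stays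
      between \<open>i\<close> and \<open>i + 1\<close> for the exchanged strings and is the integer
      \<open>z\<close> for the others, so distinct strings with equal radius are the exchanged
      pair.\<close>
    define V where "V z = real z + (real (if z = i then i + 1 else if z = i + 1 then i else z) - real z) * E" for z
    have V_in: "real i \<le> V z \<and> V z \<le> real (i + 1)" if "z = i \<or> z = i + 1" for z
      using that E by (auto simp: V_def)
    have V_out: "V z = real z" if "\<not> (z = i \<or> z = i + 1)" for z
      using that by (simp add: V_def)
    have Vxy: "V x = V y"
      using uv(6) unfolding Ru Rv stepK stepK' V_def .
    have "x = i \<or> x = i + 1"
      using V_in[of y] V_out[of x] V_out[of y] Vxy xy of_nat_le_iff[of i x, where 'a = real] of_nat_le_iff[of x "i + 1", where 'a = real]
      by (metis Suc_eq_plus1 le_SucE le_antisym of_nat_eq_iff)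
    moreover have "y = i \<or> y = i + 1"
      using V_in[of x] V_out[of x] V_out[of y] Vxy xy of_nat_le_iff[of i y, where 'a = real] of_nat_le_iff[of y "i + 1", where 'a = real]
      by (metis Suc_eq_plus1 le_SucE le_antisym of_nat_eq_iff)
    ultimately have xy_cases: "x = i \<and> y = i + 1 \<or> x = i + 1 \<and> y = i" using xy by auto
    then have "E = 1 / 2" using Vxy by (auto simp: V_def)
    then have "cos (pi * frac u) = 0" by (simp add: E_def)
    then have "frac u \<noteq> 0" by (metis cos_zero mult_zero_right zero_neq_one)
    then have "0 < pi * frac u" "pi * frac u < pi * 1"
      using frac_lt_1[of u] frac_ge_0[of u] by (auto intro!: mult_strict_left_mono)
    then have s0: "sin (pi * frac u) > 0" using sin_gt_zero by simp
    have asc': "(x = i \<and> y = i + 1 \<longrightarrow> w ! k = Gen i) \<and> (x = i + 1 \<and> y = i \<longrightarrow> w ! k = GenInv i)"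
    proof -
      have "0 < l * N" using l0 N(2) by simp
      then have "K < K + int (l * N)" by (simp only: of_nat_0_less_iff less_add_same_cancel1)
      from asc[OF k(1)[unfolded n_def] K0 this K'P k(2) trans[OF modK k(2)]] show ?thesis
        unfolding x_def y_def i_def .
    qed
    have \<sigma>K: "\<sigma> K = (if w ! k = GenInv i then -1 else 1)"
      using k by (simp add: \<sigma>_def i_def)
    have \<sigma>K': "\<sigma> (K + int (l * N)) = \<sigma> K"
      unfolding \<sigma>_def modK ..
    have Iu: "Im (Z u) = - \<sigma> K * (real (X (K + 1)) - real x) * sin (pi * frac u) / 2"
      by (simp only: ImZ x_def K_def)
    have Iv: "Im (Z v) = - \<sigma> K * (real (X (K + int (l * N) + 1)) - real y) * sin (pi * frac u) / 2"
      by (simp only: ImZ y_def K' \<sigma>K')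
    \<comment> \<open>With sign 1 the string moving right has negative height and the one moving
      left positive height; sign -1 swaps them. By \<open>asc'\<close> the earlier passage is the
      lower one either way.\<close>
    have "Im (Z u) < Im (Z v)"
      unfolding Iu Iv stepK stepK' \<sigma>K using xy_cases asc' s0 by auto
    with vP show ?thesis by simp
  qed
  \<comment> \<open>Each of the \<open>p\<close> passages contributes one point to the configuration
    at time \<open>s\<close>, its parameter shifted by a multiple of \<open>N\<close>.\<close>
  have config: "braid_config p w s = (\<lambda>m. Z (s + real (m * N))) ` {..<p}" if s: "s \<in> {0..real N}" for s
  proof -
    define K where "K = \<lfloor>s\<rfloor>"
    have fl: "\<lfloor>s + real (m * N)\<rfloor> = K + int (m * N)" "frac (s + real (m * N)) = frac s" for m
      using shift[of s "int (m * N)"] unfolding K_def of_int_of_nat_eq by auto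
    have modK: "(K + int (m * N)) mod int N = K mod int N" for m by simp
    have surj: "(\<lambda>m. X (K + int (m * N))) ` {..<p} = {1..p}"
      by (rule bij_betw_imp_surj_on[OF bij])
    show ?thesis
    proof (cases "s < real n")
      case True
      define k where "k = nat K"
      have "0 \<le> K" "K < int n"
        using True s unfolding K_def by (simp_all add: floor_less_iff)
      then have k: "K = int k" "k < n" by (auto simp: k_def)
      have Kk: "K mod int N = int k" using k N by simp
      define i where "i = I k"
      have i: "1 \<le> i" "i < p" "w ! k = Gen i \<or> w ! k = GenInv i"
        using I[of k] k by (auto simp: n_def i_def)
      define \<phi> where "\<phi> = \<sigma> K * (pi * frac s)"
      have \<sigma>K: "\<sigma> K = (if w ! k = GenInv i then -1 else 1)"
        using Kk by (simp add: \<sigma>_def i_def)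
      have \<sigma>K': "\<sigma> (K + int (m * N)) = \<sigma> K" for m
        unfolding \<sigma>_def modK ..
      have "Z (s + real (m * N)) = half_turn_point i \<phi> (X (K + int (m * N)))" for m
      proof -
        have "X (K + int (m * N) + 1) = (if X (K + int (m * N)) = i then i + 1
            else if X (K + int (m * N)) = i + 1 then i else X (K + int (m * N)))"
          unfolding i_def by (rule step[OF k(2)[unfolded n_def] trans[OF modK Kk]])
        then show ?thesis
          unfolding Zform fl \<sigma>K' \<phi>_def[symmetric] half_turn_point_def
          by (simp only: split: if_split) (auto simp: field_simps)
      qed
      then have "(\<lambda>m. Z (s + real (m * N))) ` {..<p} = half_turn_point i \<phi> ` (\<lambda>m. X (K + int (m * N))) ` {..<p}"
        by (simp add: image_image)
      also have "\<dots> = half_turn_config p i \<phi>"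
        unfolding surj using half_turn_config_image[OF i(1,2)] by simp
      also have "\<dots> = letter_config p (w ! k) (frac s)"
        using i(3) \<sigma>K by (auto simp: \<phi>_def)
      finally show ?thesis using True by (simp add: braid_config_def n_def k_def K_def)
    next
      case False
      have "Z (s + real (m * N)) = of_nat (X (K + int (m * N)))" for m
      proof (cases "s < real N")
        case True
        then have "K = int n" using False s N unfolding K_def by (simp add: floor_eq_iff)
        then have "(K + int (m * N)) mod int N = int n" using modK N by simp
        then show ?thesis using Zrest[of "s + real (m * N)"] by (simp only: fl)
      next
        case False
        then have "s = real N" using s by simp
        then have "frac s = 0" by simp
        then show ?thesis using Zint[of "s + real (m * N)"] by (simp only: fl)
      qed
      then have "(\<lambda>m. Z (s + real (m * N))) ` {..<p} = of_nat ` (\<lambda>m. X (K + int (m * N))) ` {..<p}"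
        by (simp add: image_image)
      then show ?thesis using False unfolding surj by (simp add: braid_config_def n_def)
    qed
  qed
  define \<Gamma> where "\<Gamma> u = (complex_of_real (Re (Z u)) * cis (2 * pi * u / real N), Im (Z u))" for u
  have cisN: "cis (2 * pi * (u + real (m * N)) / real N) = cis (2 * pi * u / real N)" for u m
  proof -
    have "2 * pi * (u + real (m * N)) / real N = 2 * pi * u / real N + 2 * pi * real m"
      using N by (simp add: field_simps)
    then show ?thesis using cis_multiple_2pi[of "real m"] by (simp flip: cis_mult)
  qed
  have \<Gamma>per: "\<Gamma> (u + P) = \<Gamma> u" for u
    unfolding \<Gamma>_def Zper using cisN[of u p] by (simp add: P_def)
  have "real (length w) + 1 = real N" by (simp add: N_def)
  then have closure: "braid_closure p w =
      {(of_real (Re z) * cis (2 * pi * s / real N), Im z) | s z. s \<in> {0..real N} \<and> z \<in> braid_config p w s}"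
    by (simp only: braid_closure_def)
  have "braid_closure p w = \<Gamma> ` {- (1/3)..P - 1/3}"
  proof (intro equalityI subsetI)
    fix x assume "x \<in> braid_closure p w"
    then obtain s z where s: "s \<in> {0..real N}" "z \<in> braid_config p w s"
      "x = (of_real (Re z) * cis (2 * pi * s / real N), Im z)"
      unfolding closure by blast
    then obtain m where m: "m < p" "z = Z (s + real (m * N))"
      using config[OF s(1)] by auto
    define u where "u = s + real (m * N)"
    have x: "x = \<Gamma> u" using s(3) m(2) cisN[of s m] by (simp add: \<Gamma>_def u_def)
    have "real (m + 1) * real N \<le> real p * real N" using m(1) by (intro mult_right_mono) auto
    then have "0 \<le> u" "u \<le> P" using s(1) by (auto simp: u_def P_def algebra_simps)
    \<comment> \<open>Periodicity carries the last third of the final resting arc to the front of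
      the window.\<close>
    then have "u \<in> {- (1/3)..P - 1/3} \<or> u - P \<in> {- (1/3)..P - 1/3}"
      using P1 by auto
    moreover have "x = \<Gamma> (u - P)" using x \<Gamma>per[of "u - P"] by simp
    ultimately show "x \<in> \<Gamma> ` {- (1/3)..P - 1/3}"
      using x by blast
  next
    fix x assume "x \<in> \<Gamma> ` {- (1/3)..P - 1/3}"
    then obtain u where u: "u \<in> {- (1/3)..P - 1/3}" "x = \<Gamma> u" by auto
    define u' where "u' = (if u < 0 then u + P else u)"
    have u': "0 \<le> u'" "u' < P" "x = \<Gamma> u'"
      using u P1 \<Gamma>per[of u] by (auto simp: u'_def)
    define m where "m = nat \<lfloor>u' / real N\<rfloor>"
    have m: "real m \<le> u' / real N" "u' / real N < real m + 1"
      using u'(1) by (auto simp: m_def)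
    define s where "s = u' - real (m * N)"
    have s: "0 \<le> s" "s \<le> real N"
      using m N by (auto simp: s_def field_simps)
    have "u' / real N < real p" using u'(2) N by (simp add: P_def field_simps)
    then have "m < p" using m(1) by linarith
    moreover have "u' = s + real (m * N)" by (simp add: s_def)
    ultimately have z: "Z u' \<in> braid_config p w s"
      using config[of s] s by auto
    have "x = (of_real (Re (Z u')) * cis (2 * pi * s / real N), Im (Z u'))"
      using u'(3) cisN[of s m] by (simp add: \<Gamma>_def s_def)
    then show "x \<in> braid_closure p w"
      unfolding closure using z s by auto
  qed
  then have "braid_closure p w = (\<lambda>u. (complex_of_real (Re (Z u)) * cis (2 * pi * u / real N), Im (Z u))) ` {- (1/3)..P - 1/3}"
    by (simp only: \<Gamma>_def[abs_def])
  moreover have "trivial_knot \<dots>"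
    unfolding P_def
  proof (rule trivial_knot_ascending_curve[OF N(2) p, where L = "pi / 2"])
    show "continuous_on UNIV (\<lambda>u. Re (Z u))" by (intro continuous_intros contZ)
    show "\<bar>Im (Z u) - Im (Z v)\<bar> \<le> pi / 2 * \<bar>u - v\<bar>" for u v
      using lip[of u v] abs_Im_le_cmod[of "Z u - Z v"] by simp
    show "Re (Z u) = 1 \<and> Im (Z u) = 0" if "u \<in> {-1..0} \<union> {real (p * N) - 1..real (p * N)}" for u
      using restP[of u] that by (simp add: P_def)
    show "1 \<le> Re (Z u)" for u by (rule Rge)
    show "Im (Z u) < Im (Z v) \<and> v \<le> real (p * N) - 1"
      if "- (1/3) \<le> u" "u < v" "v \<le> real (p * N) - 1/3" "v - u < real (p * N)"
        "v - u = real l * real N" "Re (Z u) = Re (Z v)" for u v l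
      using crossing[unfolded P_def, OF that] .
  qed
  ultimately show ?thesis by simp
qed

section \<open>Positions in the torus braid\<close>


lemma length_torus_word: "length (torus_word p q) = q * (p - 1)"
  by (induction q) (auto simp: torus_word_def)

lemma nth_torus_word:
  "k < q * (p - 1) \<Longrightarrow> torus_word p q ! k = Gen (k mod (p - 1) + 1)"
proof (induction q arbitrary: k)
  case (Suc q)
  show ?case
  proof (cases "k < p - 1")
    case True
    then show ?thesis by (simp add: torus_word_def nth_append)
  next
    case False
    then have "torus_word p q ! (k - (p - 1)) = Gen ((k - (p - 1)) mod (p - 1) + 1)"
      using Suc.prems by (intro Suc.IH) auto
    then show ?thesis
      using False by (simp add: torus_word_def nth_append le_mod_geq)
  qed
qed simp

lemma length_change_crossings [simp]: "length (change_crossings S w) = length w"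
  by (simp add: change_crossings_def)

lemma nth_change_crossings:
  "k < length w \<Longrightarrow> change_crossings S w ! k = (if k \<in> S then inv_letter (w ! k) else w ! k)"
  by (simp add: change_crossings_def)

lemma int_div_mod_unique:
  fixes K m :: int and k n :: nat
  assumes "K = m * int (n + 1) + int k" "k \<le> n"
  shows "K div int (n + 1) = m" "K mod int (n + 1) = int k"
  using assms by (auto intro!: int_div_pos_eq[of _ _ _ "int k"] int_mod_pos_eq[of _ _ m] simp: mult.commute)

text \<open>Splits a time into a passage \<open>m\<close> and a slot \<open>k\<close>; slot
  \<open>n\<close> is the resting arc, which is why there are \<open>n + 1\<close> slots.\<close>

lemma int_decomp:
  fixes K :: int and n :: nat
  obtains m k where "K = m * int (n + 1) + int k" "k \<le> n"
proof -
  have "0 \<le> K mod int (n + 1)" "K mod int (n + 1) < int (n + 1)"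
    by (rule pos_mod_sign pos_mod_bound; simp)+
  then have "nat (K mod int (n + 1)) \<le> n" "K = K div int (n + 1) * int (n + 1) + int (nat (K mod int (n + 1)))"
    by (linarith, simp only: nat_0_le div_mult_mod_eq)
  then show thesis using that by blast
qed

section \<open>Movers and the number of changed crossings\<close>

text \<open>
  The mover in block \<open>j\<close> is the string that crosses all the others: the passage \<open>m\<close> of the knot that
  starts the block at position 1. Passage \<open>m\<close> starts block \<open>j\<close> at position \<open>1 + (- (m q + j)) mod p\<close>.
\<close>

definition mover :: "nat \<Rightarrow> nat \<Rightarrow> nat \<Rightarrow> nat" where
  "mover p q j = (THE m. m < p \<and> p dvd m * q + j)"

context
  fixes p q :: nat
  assumes p: "p \<ge> 1" and q: "q \<ge> 1" and coprime: "coprime p q"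
begin

text \<open>Here coprimality acts: \<open>q\<close> can be cancelled modulo \<open>p\<close>, so
  different passages never start a block at the same position.\<close>

lemma label_unique:
  assumes "m < p" "m' < p" "p dvd m * q + j" "p dvd m' * q + j"
  shows "m = m'"
proof -
  have "int p dvd (int m * int q + int j) - (int m' * int q + int j)"
    using assms(3,4) by (metis dvd_diff of_nat_add of_nat_dvd_iff of_nat_mult)
  then have "int p dvd (int m - int m') * int q" by (simp add: algebra_simps)
  then have "int p dvd int m - int m'"
    using coprime by (simp add: coprime_dvd_mult_left_iff)
  then show ?thesis
    using assms(1,2) dvd_imp_le_int[of "int m - int m'" "int p"] by (cases "m = m'") auto
qed

lemma label_exists: "\<exists>m<p. p dvd m * q + j"
proof -
  have "inj_on (\<lambda>m. (m * q + j) mod p) {..<p}"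
  proof (rule inj_onI)
    fix m m' assume m: "m \<in> {..<p}" "m' \<in> {..<p}" and "(m * q + j) mod p = (m' * q + j) mod p"
    then have "int (m * q + j) mod int p = int (m' * q + j) mod int p"
      by (metis zmod_int)
    then have "int p dvd int (m * q + j) - int (m' * q + j)" by (simp only: mod_eq_dvd_iff)
    then have "int p dvd (int m - int m') * int q" by (simp add: algebra_simps)
    then have "int p dvd int m - int m'"
      using coprime by (simp add: coprime_dvd_mult_left_iff)
    then show "m = m'"
      using m dvd_imp_le_int[of "int m - int m'" "int p"] by (cases "m = m'") auto
  qed
  then have "(\<lambda>m. (m * q + j) mod p) ` {..<p} = {..<p}"
    using p by (intro endo_inj_surj) auto
  then have "0 \<in> (\<lambda>m. (m * q + j) mod p) ` {..<p}" using p by auto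
  then show ?thesis by (auto simp: dvd_eq_mod_eq_0)
qed

lemma mover_props: "mover p q j < p" "p dvd mover p q j * q + j"
proof -
  have "\<exists>!m. m < p \<and> p dvd m * q + j"
    using label_exists label_unique by blast
  from theI'[OF this] show "mover p q j < p" "p dvd mover p q j * q + j"
    by (auto simp: mover_def)
qed

lemma mover_eqI: "m < p \<Longrightarrow> p dvd m * q + j \<Longrightarrow> mover p q j = m"
  using mover_props label_unique by blast

text \<open>If \<open>p\<close> divides \<open>m * q + j\<close>, it also divides
  \<open>p * q - (m * q + j) = (p - 1 - m) * q + (q - j)\<close>, so the movers of blocks
  \<open>j\<close> and \<open>q - j\<close> add up to \<open>p - 1\<close>. Block 0 has mover 0 and
  adds nothing.\<close>

lemma sum_mover: "(\<Sum>j<q. mover p q j) = (p - 1) * (q - 1) div 2"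
proof -
  have sym: "mover p q (q - j) = p - 1 - mover p q j" if j: "j \<in> {1..<q}" for j
  proof (rule mover_eqI)
    define m where "m = mover p q j"
    have m: "m < p" "p dvd m * q + j" using mover_props by (auto simp: m_def)
    obtain l where "p = Suc (m + l)" using less_imp_Suc_add[OF m(1)] by blast
    then have l: "p = m + 1 + l" by simp
    obtain s where s: "q = j + s" using le_Suc_ex[of j q] j by auto
    have "(l * q + s) + (m * q + j) = p * q" unfolding l using s by (simp add: algebra_simps)
    moreover have "p - 1 - m = l" "q - j = s" using l s by auto
    ultimately have "p dvd (p - 1 - m) * q + (q - j)"
      using m(2) by (metis dvd_add_left_iff dvd_triv_left)
    then show "p dvd (p - 1 - mover p q j) * q + (q - j)"
      unfolding m_def .
  qed (use p in auto)
  have "mover p q 0 = 0" by (rule mover_eqI) (use p in auto)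
  then have "(\<Sum>j<q. mover p q j) = (\<Sum>j\<in>{1..<q}. mover p q j)"
    by (intro sum.mono_neutral_right) (auto simp: Suc_le_eq)
  moreover have "(\<Sum>j\<in>{1..<q}. mover p q j) = (\<Sum>j\<in>{1..<q}. mover p q (q - j))"
    by (rule sum.reindex_bij_witness[of _ "\<lambda>j. q - j" "\<lambda>j. q - j"]) auto
  ultimately have "2 * (\<Sum>j<q. mover p q j) = (\<Sum>j\<in>{1..<q}. mover p q j + mover p q (q - j))"
    by (simp add: sum.distrib)
  also have "\<dots> = (\<Sum>j\<in>{1..<q}. p - 1)"
  proof (rule sum.cong[OF refl])
    fix j assume "j \<in> {1..<q}"
    then show "mover p q j + mover p q (q - j) = p - 1"
      using sym[of j] mover_props(1)[of j] by simp
  qed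
  also have "\<dots> = (p - 1) * (q - 1)" by simp
  finally show ?thesis by simp
qed

text \<open>Crossing \<open>k\<close> lies in block \<open>j = k div (p - 1)\<close> and has
  generator index \<open>i = k mod (p - 1) + 1\<close>. The string met there by the mover is the
  passage \<open>m\<close> with \<open>p\<close> dividing \<open>m * q + j + i\<close>; the crossing
  is changed when that passage precedes the mover.\<close>

definition overtaken :: "nat set" where
  "overtaken = {k. k < q * (p - 1) \<and>
    (\<exists>m<mover p q (k div (p - 1)). p dvd m * q + k div (p - 1) + k mod (p - 1) + 1)}"

text \<open>In each block the mover meets every earlier passage exactly once, so the changed
  crossings correspond to the pairs of a block and a passage earlier than its mover.\<close>

lemma card_overtaken: "card overtaken = (p - 1) * (q - 1) div 2"
proof -
  \<comment> \<open>Passage \<open>m\<close> starts block \<open>j\<close> at position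
    \<open>r j m + 2\<close>, so the mover meets it at the generator of index
    \<open>r j m + 1\<close>.\<close>
  define r where "r j m = p - 1 - (m * q + j) mod p" for j m
  define f where "f = (\<lambda>(j, m). j * (p - 1) + r j m)"
  let ?A = "SIGMA j:{..<q}. {..<mover p q j}"
  have r: "r j m < p - 1" "p dvd m * q + j + r j m + 1" if "m < mover p q j" for j m
  proof -
    have "\<not> p dvd m * q + j"
      using mover_eqI[of m j] mover_props(1)[of j] that by auto
    then have "(m * q + j) mod p > 0" by (simp add: dvd_eq_mod_eq_0)
    moreover have lt: "(m * q + j) mod p < p" using p by simp
    ultimately show "r j m < p - 1" by (auto simp: r_def)
    have "r j m + 1 + (m * q + j) mod p = p" using lt by (auto simp: r_def)
    moreover have "p * ((m * q + j) div p) + (m * q + j) mod p = m * q + j" by (rule mult_div_mod_eq)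
    ultimately have "m * q + j + r j m + 1 = p * ((m * q + j) div p) + p" by linarith
    then show "p dvd m * q + j + r j m + 1" by simp
  qed
  have f_div: "f (j, m) div (p - 1) = j" "f (j, m) mod (p - 1) = r j m" if "m < mover p q j" for j m
    using r(1)[OF that] by (auto simp: f_def)
  have inj: "inj_on f ?A"
  proof (rule inj_onI)
    fix a b assume ab: "a \<in> ?A" "b \<in> ?A" and eq: "f a = f b"
    obtain j m j' m' where a: "a = (j, m)" and b: "b = (j', m')" by (metis surj_pair)
    have m: "m < mover p q j" "m' < mover p q j'" using ab by (auto simp: a b)
    have j: "j = j'" and rr: "r j m = r j' m'"
      using f_div[OF m(1)] f_div[OF m(2)] eq by (auto simp: a b)
    have "m = m'"
    proof (rule label_unique)
      show "m < p" "m' < p"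
        using m mover_props(1) less_trans by blast+
      show "p dvd m * q + (j + r j m + 1)" "p dvd m' * q + (j + r j m + 1)"
        using r(2)[OF m(1)] r(2)[OF m(2)] unfolding rr[symmetric] unfolding j[symmetric] by (simp_all only: add.assoc)
    qed
    with j show "a = b" by (simp add: a b)
  qed
  have "f ` ?A = overtaken"
  proof (intro equalityI subsetI)
    fix k assume "k \<in> f ` ?A"
    then obtain j m where jm: "j < q" "m < mover p q j" "k = f (j, m)" by auto
    have "k < (j + 1) * (p - 1)" using r(1)[OF jm(2)] jm(3) by (simp add: f_def)
    also have "\<dots> \<le> q * (p - 1)" using jm(1) by (intro mult_right_mono) auto
    finally show "k \<in> overtaken"
      using jm f_div[OF jm(2)] r(2)[OF jm(2)] by (auto simp: overtaken_def)
  next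
    fix k assume "k \<in> overtaken"
    then obtain m where k: "k < q * (p - 1)" and m: "m < mover p q (k div (p - 1))"
      "p dvd m * q + k div (p - 1) + k mod (p - 1) + 1"
      by (auto simp: overtaken_def)
    have "p - 1 > 0" using k by (cases "p - 1") auto
    then have j: "k div (p - 1) < q" and "k mod (p - 1) < p - 1"
      using k by (auto simp: div_less_iff_less_mult)
    define j where "j = k div (p - 1)"
    have "int p dvd int (m * q + j + r j m + 1) - int (m * q + j + k mod (p - 1) + 1)"
      using m r(2)[of m j] unfolding j_def by (intro dvd_diff) (simp_all only: of_nat_dvd_iff)
    then have "int p dvd int (r j m) - int (k mod (p - 1))" by simp
    moreover have "\<bar>int (r j m) - int (k mod (p - 1))\<bar> < int p"
      using r(1)[OF m(1), folded j_def] \<open>k mod (p - 1) < p - 1\<close> by linarith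
    ultimately have "r j m = k mod (p - 1)"
      using dvd_imp_le_int[of "int (r j m) - int (k mod (p - 1))" "int p"] by force
    then have "k = f (j, m)" unfolding f_def prod.case j_def by (metis div_mult_mod_eq)
    then show "k \<in> f ` ?A" using j m(1) by (auto simp: j_def)
  qed
  then have "card overtaken = card ?A" using card_image[OF inj] by simp
  also have "\<dots> = (\<Sum>j<q. mover p q j)" by (simp add: card_SigmaI)
  finally show ?thesis using sum_mover by simp
qed

section \<open>Positions of the strings within a block\<close>

text \<open>
  After \<open>i\<close> letters of a block, the string that started the block at position \<open>x + 1\<close> is at
  \<open>slot_pos i x\<close>: the mover (\<open>x = 0\<close>) has advanced \<open>i\<close> places and the strings it met have gone down by one.
  The time \<open>K\<close> in \<open>torus_pos\<close> counts letters along the knot, plus one for the resting arc of each passage.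
\<close>

definition slot_pos :: "nat \<Rightarrow> nat \<Rightarrow> nat" where
  "slot_pos i x = (if x = 0 then i + 1 else if x \<le> i then x else x + 1)"

text \<open>For \<open>a = m * q + j\<close> this is the starting position of passage
  \<open>m\<close> in block \<open>j\<close>, minus one. The argument is an integer because times
  along the knot may be negative.\<close>

definition residue :: "int \<Rightarrow> nat" where
  "residue a = nat (- a mod int p)"

definition torus_pos :: "int \<Rightarrow> nat" where
  "torus_pos K =
    (let N = q * (p - 1) + 1; k = nat (K mod int N)
     in slot_pos (k mod (p - 1)) (residue (K div int N * int q + int (k div (p - 1)))))"

text \<open>After \<open>i\<close> letters the next one exchanges positions \<open>i + 1\<close> and
  \<open>i + 2\<close>. They hold the mover and the string that started the block at position
  \<open>i + 2\<close>.\<close>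

lemma slot_pos_eq: "slot_pos i x = i + 1 \<longleftrightarrow> x = 0" "slot_pos i x = i + 2 \<longleftrightarrow> x = i + 1"
  by (auto simp: slot_pos_def)

lemma slot_pos_inj: "slot_pos i x = slot_pos i y \<Longrightarrow> x = y"
  by (auto simp: slot_pos_def split: if_splits)

lemma slot_pos_range: "x < p \<Longrightarrow> i < p \<Longrightarrow> slot_pos i x \<in> {1..p}"
  by (auto simp: slot_pos_def)

lemma int_residue: "int (residue a) = - a mod int p"
  using p by (simp add: residue_def)

lemma residue_less: "residue a < p"
  using p int_residue[of a] pos_mod_bound[of "int p" "- a"] by linarith

lemma residue_eq_iff: "r < p \<Longrightarrow> residue a = r \<longleftrightarrow> int p dvd a + int r"
proof -
  assume r: "r < p"
  have "residue a = r \<longleftrightarrow> - a mod int p = int r mod int p"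
    using int_residue[of a] r by auto
  also have "\<dots> \<longleftrightarrow> int p dvd - (a + int r)"
    by (simp only: mod_eq_dvd_iff minus_add_distrib diff_conv_add_uminus)
  finally show ?thesis by (simp only: dvd_minus_iff)
qed

lemma residue_add_multiple: "residue (a + int p * b) = residue a"
proof -
  have "int p dvd a + int p * b + int (residue a) \<longleftrightarrow> int p dvd a + int (residue a)"
    by (metis add.assoc add.commute dvd_add_left_iff dvd_triv_left)
  then show ?thesis
    using residue_eq_iff[OF residue_less] by metis
qed

text \<open>The effect of a whole block: the string at position 1 goes to position \<open>p\<close>,
  and all others go down by one.\<close>

lemma residue_add_1: "residue (a + 1) = (if residue a = 0 then p - 1 else residue a - 1)"
proof -
  have *: "int p dvd a + int (residue a)" using residue_eq_iff[OF residue_less] by metis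
  show ?thesis
  proof (cases "residue a = 0")
    case True
    then have "int p dvd a + 1 + int (p - 1)"
      using * p by (simp add: of_nat_diff)
    then show ?thesis using residue_eq_iff[of "p - 1" "a + 1"] True p by simp
  next
    case False
    then have "int p dvd a + 1 + int (residue a - 1)"
      using * by (simp add: of_nat_diff)
    then show ?thesis using residue_eq_iff[of "residue a - 1" "a + 1"] False residue_less[of a] by simp
  qed
qed

lemma torus_pos_eq:
  assumes "K = m * int (q * (p - 1) + 1) + int k" "k \<le> q * (p - 1)"
  shows "torus_pos K = slot_pos (k mod (p - 1)) (residue (m * int q + int (k div (p - 1))))"
  using int_div_mod_unique[OF assms] by (simp only: torus_pos_def Let_def nat_int)

lemma torus_pos_step:
  assumes k: "k < q * (p - 1)" and K: "K mod int (q * (p - 1) + 1) = int k"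
  defines "i \<equiv> k mod (p - 1) + 1"
  shows "torus_pos (K + 1) =
    (if torus_pos K = i then i + 1 else if torus_pos K = i + 1 then i else torus_pos K)"
proof -
  obtain m where m: "K = m * int (q * (p - 1) + 1) + int k"
    by (metis K div_mult_mod_eq)
  define l j where "l = k mod (p - 1)" and "j = k div (p - 1)"
  define x where "x = residue (m * int q + int j)"
  have p2: "p - 1 > 0" using k by (cases "p - 1") auto
  then have l: "l < p - 1" by (simp add: l_def)
  have x: "x < p" by (simp add: x_def residue_less)
  have K0: "torus_pos K = slot_pos l x"
    using torus_pos_eq[OF m] k by (simp add: l_def x_def j_def)
  have "K + 1 = m * int (q * (p - 1) + 1) + int (Suc k)" using m by simp
  from torus_pos_eq[OF this] k
  have K1: "torus_pos (K + 1) = slot_pos (Suc k mod (p - 1)) (residue (m * int q + int (Suc k div (p - 1))))"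
    by simp
  show ?thesis
  proof (cases "Suc l = p - 1")
    case False
    then have "Suc k mod (p - 1) = Suc l" "Suc k div (p - 1) = j"
      by (auto simp: l_def j_def mod_Suc div_Suc)
    then have "torus_pos (K + 1) = slot_pos (Suc l) x" using K1 by (simp add: x_def)
    then show ?thesis
      unfolding K0 i_def l_def[symmetric] by (auto simp: slot_pos_def)
  next
    \<comment> \<open>The last letter of a block: the exchange must lead to the starting positions
      of the next block, where the residues have been rotated by one.\<close>
    case True
    then have "Suc k mod (p - 1) = 0" "Suc k div (p - 1) = Suc j"
      by (auto simp: l_def j_def mod_Suc div_Suc)
    then have "torus_pos (K + 1) = slot_pos 0 (residue (m * int q + int j + 1))"
      using K1 by (simp add: algebra_simps)
    then have "torus_pos (K + 1) = slot_pos 0 (if x = 0 then p - 1 else x - 1)"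
      by (simp only: residue_add_1 x_def)
    then show ?thesis
      unfolding K0 i_def l_def[symmetric] using True x p2 by (auto simp: slot_pos_def)
  qed
qed

lemma torus_pos_rest:
  assumes K: "K mod int (q * (p - 1) + 1) = int (q * (p - 1))"
  shows "torus_pos (K + 1) = torus_pos K"
proof -
  obtain m where m: "K = m * int (q * (p - 1) + 1) + int (q * (p - 1))"
    by (metis K div_mult_mod_eq)
  then have "K + 1 = (m + 1) * int (q * (p - 1) + 1) + int 0"
    by (simp add: algebra_simps)
  from torus_pos_eq[OF this]
  have K1: "torus_pos (K + 1) = slot_pos 0 (residue ((m + 1) * int q))" by simp
  have K0: "torus_pos K = slot_pos 0 (residue (m * int q + int (q * (p - 1) div (p - 1))))"
    using torus_pos_eq[OF m] by simp
  show ?thesis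
  \<comment> \<open>The end of block \<open>q - 1\<close> of passage \<open>m\<close> is the start
    of passage \<open>m + 1\<close>, as \<open>m * q + q = (m + 1) * q\<close>. For
    \<open>p = 1\<close> the division by \<open>p - 1\<close> is a division by 0 and does not return
    \<open>q\<close>, but all residues are 0.\<close>
  proof (cases "p = 1")
    case True
    then have "residue a = 0" for a using residue_less[of a] by simp
    then show ?thesis by (simp only: K0 K1)
  next
    case False
    then have "q * (p - 1) div (p - 1) = q" using p by simp
    then show ?thesis by (simp only: K0 K1 distrib_right mult_1)
  qed
qed

lemma torus_pos_bij:
  "bij_betw (\<lambda>m. torus_pos (K + int (m * (q * (p - 1) + 1)))) {..<p} {1..p}"
proof -
  obtain m0 k where K: "K = m0 * int (q * (p - 1) + 1) + int k" and k: "k \<le> q * (p - 1)"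
    by (rule int_decomp)
  define l j where "l = k mod (p - 1)" and "j = k div (p - 1)"
  have l: "l < p"
  proof (cases "p = 1")
    case True
    then show ?thesis using k by (simp add: l_def)
  next
    case False
    then have "l < p - 1" using p unfolding l_def by (intro mod_less_divisor) auto
    then show ?thesis by simp
  qed
  have pos: "torus_pos (K + int (m * (q * (p - 1) + 1))) = slot_pos l (residue ((m0 + int m) * int q + int j))" for m
  proof -
    have "K + int (m * (q * (p - 1) + 1)) = (m0 + int m) * int (q * (p - 1) + 1) + int k"
      unfolding K of_nat_mult distrib_right by simp
    from torus_pos_eq[OF this k] show ?thesis by (simp only: l_def j_def)
  qed
  have inj: "inj_on (\<lambda>m. torus_pos (K + int (m * (q * (p - 1) + 1)))) {..<p}"
  proof (rule inj_onI)
    fix m m' assume m: "m \<in> {..<p}" "m' \<in> {..<p}"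
      and eq: "torus_pos (K + int (m * (q * (p - 1) + 1))) = torus_pos (K + int (m' * (q * (p - 1) + 1)))"
    define r where "r = residue ((m0 + int m) * int q + int j)"
    have "residue ((m0 + int m') * int q + int j) = r"
      using eq slot_pos_inj unfolding pos r_def by metis
    then have "int p dvd ((m0 + int m) * int q + int j + int r) - ((m0 + int m') * int q + int j + int r)"
      using residue_eq_iff[OF residue_less] r_def by (metis dvd_diff)
    then have "int p dvd (int m - int m') * int q" by (simp add: algebra_simps)
    then have "int p dvd int m - int m'"
      using coprime by (simp add: coprime_dvd_mult_left_iff)
    then show "m = m'"
      using m dvd_imp_le_int[of "int m - int m'" "int p"] by (cases "m = m'") auto
  qed
  moreover have "(\<lambda>m. torus_pos (K + int (m * (q * (p - 1) + 1)))) ` {..<p} = {1..p}"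
  proof (rule card_subset_eq)
    show "(\<lambda>m. torus_pos (K + int (m * (q * (p - 1) + 1)))) ` {..<p} \<subseteq> {1..p}"
      unfolding pos using slot_pos_range[OF residue_less l] by blast
    show "card ((\<lambda>m. torus_pos (K + int (m * (q * (p - 1) + 1)))) ` {..<p}) = card {1..p}"
      using card_image[OF inj] by simp
  qed simp
  ultimately show ?thesis by (simp add: bij_betw_def)
qed

lemma torus_pos_periodic: "torus_pos (K + int (p * (q * (p - 1) + 1))) = torus_pos K"
proof -
  obtain m k where K: "K = m * int (q * (p - 1) + 1) + int k" and k: "k \<le> q * (p - 1)"
    by (rule int_decomp)
  have "K + int (p * (q * (p - 1) + 1)) = (m + int p) * int (q * (p - 1) + 1) + int k"
    unfolding K of_nat_mult distrib_right by simp
  from torus_pos_eq[OF this k]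
  have "torus_pos (K + int (p * (q * (p - 1) + 1))) =
      slot_pos (k mod (p - 1)) (residue (m * int q + int (k div (p - 1)) + int p * int q))"
    by (simp add: algebra_simps)
  then show ?thesis unfolding residue_add_multiple torus_pos_eq[OF K k] .
qed

text \<open>At the same letter, the order of travel is the order of the passages. The string at
  position \<open>i\<close> is the mover and the one at \<open>i + 1\<close> is the string it meets,
  so the crossing is changed exactly when the latter comes first.\<close>

lemma torus_pos_overtaken:
  assumes k: "k < q * (p - 1)" and K: "0 \<le> K" "K < K'" "K' < int (p * (q * (p - 1) + 1))"
    and mod: "K mod int (q * (p - 1) + 1) = int k" "K' mod int (q * (p - 1) + 1) = int k"
  defines "i \<equiv> k mod (p - 1) + 1"
  shows "torus_pos K = i \<Longrightarrow> torus_pos K' = i + 1 \<Longrightarrow> k \<notin> overtaken"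
    and "torus_pos K = i + 1 \<Longrightarrow> torus_pos K' = i \<Longrightarrow> k \<in> overtaken"
proof -
  define N where "N = int (q * (p - 1) + 1)"
  have N: "N > 0" unfolding N_def of_nat_0_less_iff by simp
  define m m' where "m = nat (K div N)" and "m' = nat (K' div N)"
  have "0 \<le> K div N" "0 \<le> K' div N" using K N by (auto simp: pos_imp_zdiv_nonneg_iff)
  then have m: "K = int m * N + int k" "K' = int m' * N + int k"
    using mod unfolding m_def m'_def N_def[symmetric] by (metis div_mult_mod_eq nat_0_le)+
  have "int m * N < int m' * N" using K(2) m by simp
  then have mm': "m < m'" using N by simp
  have "K' < int p * N" using K(3) unfolding N_def of_nat_mult .
  then have "int m' * N < int p * N" using m(2) by linarith
  then have m'p: "m' < p" using N by simp
  define j where "j = k div (p - 1)"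
  have p2: "p - 1 > 0" using k by (cases "p - 1") auto
  then have "k mod (p - 1) < p - 1" by simp
  then have i: "i < p" by (simp add: i_def)
  have pos: "torus_pos (int l * N + int k) = i \<longleftrightarrow> p dvd l * q + j"
    "torus_pos (int l * N + int k) = i + 1 \<longleftrightarrow> p dvd l * q + j + i" for l
  proof -
    define x where "x = residue (int l * int q + int j)"
    have eq: "torus_pos (int l * N + int k) = slot_pos (k mod (p - 1)) x"
      using torus_pos_eq[of "int l * N + int k" "int l" k] k by (simp only: N_def j_def x_def less_imp_le)
    have x: "x = r \<longleftrightarrow> p dvd l * q + j + r" if "r < p" for r
      unfolding x_def residue_eq_iff[OF that] by (simp only: of_nat_dvd_iff flip: of_nat_mult of_nat_add)
    show "torus_pos (int l * N + int k) = i \<longleftrightarrow> p dvd l * q + j"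
      using x[of 0] p slot_pos_eq(1)[of "k mod (p - 1)" x] by (simp add: eq i_def)
    show "torus_pos (int l * N + int k) = i + 1 \<longleftrightarrow> p dvd l * q + j + i"
      using x[OF i] slot_pos_eq(2)[of "k mod (p - 1)" x] by (simp add: eq i_def)
  qed
  have over: "k \<in> overtaken \<longleftrightarrow> (\<exists>l<mover p q j. p dvd l * q + j + i)"
    using k by (simp add: overtaken_def j_def i_def add.assoc)
  show "k \<notin> overtaken" if "torus_pos K = i" "torus_pos K' = i + 1"
  proof
    assume "k \<in> overtaken"
    then obtain l where l: "l < mover p q j" "p dvd l * q + j + i" using over by blast
    have "mover p q j = m"
      using that(1) mm' m'p unfolding m(1) pos by (intro mover_eqI) auto
    moreover have "l = m'"
      using that(2) l mover_props(1)[of j] m'p unfolding m(2) pos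
      by (intro label_unique[of l m' "j + i"]) (auto simp: add.assoc)
    ultimately show False using l mm' by simp
  qed
  show "k \<in> overtaken" if "torus_pos K = i + 1" "torus_pos K' = i"
  proof -
    have "mover p q j = m'"
      using that(2) m'p unfolding m(2) pos by (intro mover_eqI) auto
    then show ?thesis
      using that(1) mm' unfolding over m(1) pos by blast
  qed
qed

end


theorem mainTheorem4:
  fixes p q :: nat
  assumes "p \<ge> 1" and "q \<ge> 1" and "coprime p q"
  shows "\<exists>S \<subseteq> {..<length (torus_word p q)}.
           card S = (p - 1) * (q - 1) div 2 \<and>
           trivial_knot (braid_closure p (change_crossings S (torus_word p q)))"
proof (intro exI conjI)
  let ?S = "overtaken p q" and ?n = "q * (p - 1)"
  let ?w = "change_crossings ?S (torus_word p q)"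
  show "?S \<subseteq> {..<length (torus_word p q)}"
    by (auto simp: overtaken_def[OF assms] length_torus_word)
  show "card ?S = (p - 1) * (q - 1) div 2"
    by (rule card_overtaken[OF assms])
  have len: "length ?w = ?n" by (simp add: length_torus_word)
  have nth: "?w ! k = (if k \<in> ?S then GenInv (k mod (p - 1) + 1) else Gen (k mod (p - 1) + 1))" if "k < ?n" for k
    using that by (simp add: nth_change_crossings length_torus_word nth_torus_word)
  show "trivial_knot (braid_closure p ?w)"
  proof (rule trivial_knot_ascending_braid[where X = "torus_pos p q" and I = "\<lambda>k. k mod (p - 1) + 1"], unfold len)
    show "p \<ge> 1" by fact
    show "torus_pos p q (K + int (p * (?n + 1))) = torus_pos p q K" for K
      by (rule torus_pos_periodic[OF assms])
    show "bij_betw (\<lambda>m. torus_pos p q (K + int (m * (?n + 1)))) {..<p} {1..p}" for K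
      by (rule torus_pos_bij[OF assms])
    show "torus_pos p q 0 = 1"
      by (simp add: torus_pos_def[OF assms] slot_pos_def[OF assms] residue_def[OF assms])
    show "torus_pos p q (K + 1) = torus_pos p q K" if "K mod int (?n + 1) = int ?n" for K
      by (rule torus_pos_rest[OF assms that])
    show "1 \<le> k mod (p - 1) + 1 \<and> k mod (p - 1) + 1 < p \<and>
        (?w ! k = Gen (k mod (p - 1) + 1) \<or> ?w ! k = GenInv (k mod (p - 1) + 1))" if k: "k < ?n" for k
    proof -
      have "p - 1 > 0" using k by (cases "p - 1") auto
      then have "k mod (p - 1) < p - 1" by simp
      then show ?thesis using nth[OF k] by auto
    qed
    show "torus_pos p q (K + 1) = (if torus_pos p q K = k mod (p - 1) + 1 then k mod (p - 1) + 1 + 1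
        else if torus_pos p q K = k mod (p - 1) + 1 + 1 then k mod (p - 1) + 1 else torus_pos p q K)"
      if "k < ?n" "K mod int (?n + 1) = int k" for K k
      by (rule torus_pos_step[OF assms that])
    show "(torus_pos p q K = k mod (p - 1) + 1 \<and> torus_pos p q K' = k mod (p - 1) + 1 + 1 \<longrightarrow>
          ?w ! k = Gen (k mod (p - 1) + 1)) \<and>
        (torus_pos p q K = k mod (p - 1) + 1 + 1 \<and> torus_pos p q K' = k mod (p - 1) + 1 \<longrightarrow>
          ?w ! k = GenInv (k mod (p - 1) + 1))"
      if "k < ?n" "0 \<le> K" "K < K'" "K' < int (p * (?n + 1))"
        "K mod int (?n + 1) = int k" "K' mod int (?n + 1) = int k" for K K' k
      using torus_pos_overtaken[OF assms that] nth[OF that(1)] by auto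
  qed
qed

end
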